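(* Let $n,m$ be positive integers with $n+1\le m\le 2n$, let $\Omega\subseteq\mathbb{R}^m$ be an open set and let $f=(f^1,\dots,f^{2n+1})\in W^{1,1}_{\mathrm{loc}}(\Omega,\mathbb{R}^{2n+1})$ satisfy $$df^{2n+1}=\sum_{j=1}^n\big(f^j\,df^{j+n}-f^{j+n}\,df^j\big)\quad\text{almost everywhere in }\Omega.$$ Then the Jacobian matrix $Df$ has rank at most $n$ almost everywhere in $\Omega$.
   Context: Differentials are weak (Sobolev) differentials, defined almost everywhere. *)

theory Defs
  imports "HOL-Analysis.Analysis"
begin

text \<open>C-infinity functions on the whole space: a family D of iterated partial
  derivatives, indexed by lists of coordinate directions, such that each D ks is
  (Frechet) differentiable everywhere with partial derivatives D (i # ks).\<close>
definition smooth_fun :: "(real^'m \<Rightarrow> real) \<Rightarrow> bool" where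
  "smooth_fun \<phi> \<longleftrightarrow> (\<exists>D :: 'm list \<Rightarrow> real^'m \<Rightarrow> real. D [] = \<phi> \<and>
     (\<forall>ks x. (D ks has_derivative (\<lambda>h. \<Sum>i\<in>UNIV. h $ i * D (i # ks) x)) (at x)))"

definition partial :: "'m::finite \<Rightarrow> (real^'m \<Rightarrow> real) \<Rightarrow> real^'m \<Rightarrow> real" where
  "partial i \<phi> x = frechet_derivative \<phi> (at x) (axis i 1)"

definition test_fun :: "(real^'m) set \<Rightarrow> (real^'m \<Rightarrow> real) \<Rightarrow> bool" where
  "test_fun \<Omega> \<phi> \<longleftrightarrow> smooth_fun \<phi> \<and> compact (closure {x. \<phi> x \<noteq> 0})
     \<and> closure {x. \<phi> x \<noteq> 0} \<subseteq> \<Omega>"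

definition loc_integrable :: "(real^'m) set \<Rightarrow> (real^'m \<Rightarrow> real) \<Rightarrow> bool" where
  "loc_integrable \<Omega> u \<longleftrightarrow> (\<forall>K. compact K \<and> K \<subseteq> \<Omega> \<longrightarrow> u absolutely_integrable_on K)"

definition weak_partial :: "(real^'m) set \<Rightarrow> (real^'m \<Rightarrow> real) \<Rightarrow> 'm \<Rightarrow> (real^'m \<Rightarrow> real) \<Rightarrow> bool" where
  "weak_partial \<Omega> u i v \<longleftrightarrow> loc_integrable \<Omega> u \<and> loc_integrable \<Omega> v \<and>
     (\<forall>\<phi>. test_fun \<Omega> \<phi> \<longrightarrow>
        integral \<Omega> (\<lambda>x. u x * partial i \<phi> x) = - integral \<Omega> (\<lambda>x. v x * \<phi> x))"

end

theory Submission
  imports Defs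
begin

text \<open>Taking the exterior derivative of the contact equation formally gives
  \<open>\<Sum>\<^sub>j df\<^sup>j \<and> df\<^sup>j\<^sup>+\<^sup>n = 0\<close>, so the image of the differential is isotropic for a symplectic form on
  a space of dimension \<open>2n\<close>, hence of dimension at most \<open>n\<close>. For \<open>W\<^sup>1\<^sup>,\<^sup>1\<close> maps the products on the
  right-hand side need not be weakly differentiable, and the contour integral of the contact form
  replaces the exterior derivative. For fixed \<open>r\<close> and almost every \<open>p\<close>, the map is absolutely
  continuous along the boundary of the coordinate square of side \<open>r\<close> with corner \<open>p\<close>, where the
  contact form therefore integrates to zero. Comparing \<open>Df\<close> on the boundary with the constant
  \<open>Df(p)\<close>, the value of \<open>\<Sum>\<^sub>j df\<^sup>j \<and> df\<^sup>j\<^sup>+\<^sup>n\<close> at \<open>p\<close> is bounded by the mean oscillation of \<open>Df\<close> around \<open>p\<close>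
  along that boundary. By continuity of translations in \<open>L\<^sup>1\<close> this mean oscillation tends to zero in
  \<open>L\<^sup>1\<close> as \<open>r \<rightarrow> 0\<close>, and almost everywhere along a subsequence.\<close>

section \<open>Isotropic families of vectors\<close>

text \<open>For \<open>W^{1,1}\<close> maps the products \<open>f^j df^{j+n}\<close> need not even
  be locally integrable, so they are never tested in dimension \<open>m\<close>. On almost every
  segment, however, each \<open>f^k\<close> is absolutely continuous, hence bounded, and its product
  with an integrable derivative is integrable. As \<open>f\<close> has no bound near
  \<open>p\<close>, the values \<open>f^k(p)\<close> must stay out of the error: freezing the
  coefficients of the contact form at \<open>p\<close> gives an exact form, whose increments cancel
  around the square, and only the rest is estimated. The area term has order \<open>r^2\<close>, the
  errors are \<open>r C D + D^2\<close> up to constants, where \<open>C\<close> bounds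
  \<open>Df(p)\<close> and \<open>D\<close> bounds the integral of \<open>|Df - Df(p)|\<close> over
  each edge. Dividing by \<open>r^2\<close> leaves an error in \<open>C\<close> and
  \<open>D / r\<close>, and \<open>D / r\<close> is controlled by mean oscillation. The null set of
  bad corners depends on \<open>r\<close>, hence only countably many sides are used. The contact
  equation itself puts the last row of \<open>Df\<close> into the span of the others, so that
  isotropy of the first \<open>2n\<close> rows settles the rank.\<close>

text \<open>The hypothesis says that the sum of the 2-vectors a_j \<and> b_j vanishes. Each pair
  costs one dimension: contracting with a coordinate in which \<open>a j0\<close> is nonzero
  expresses \<open>b j0\<close> through \<open>a j0\<close> and the other pairs, and those pairs,
  reduced modulo \<open>a j0\<close>, satisfy the same relation. If \<open>a j0\<close> is zero,
  only \<open>b j0\<close> can enlarge the span.\<close>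

lemma dim_isotropic_le:
  fixes a b :: "'j \<Rightarrow> real^'m"
  assumes "finite J"
    and "\<And>k l. (\<Sum>j\<in>J. a j $ k * b j $ l - b j $ k * a j $ l) = 0"
  shows "dim (a ` J \<union> b ` J) \<le> card J"
  using assms
proof (induction J arbitrary: a b rule: finite_induct)
  case empty
  then show ?case by simp
next
  case (insert j0 J)
  have rel: "a j0 $ k * b j0 $ l - b j0 $ k * a j0 $ l
      + (\<Sum>j\<in>J. a j $ k * b j $ l - b j $ k * a j $ l) = 0" for k l
    using insert.prems[of k l] insert.hyps by simp
  show ?case
  proof (cases "a j0 = 0")
    case True
    then have "(\<Sum>j\<in>J. a j $ k * b j $ l - b j $ k * a j $ l) = 0" for k l
      using rel[of k l] by simp
    then have IH: "dim (a ` J \<union> b ` J) \<le> card J"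
      by (rule insert.IH)
    have "dim (a ` insert j0 J \<union> b ` insert j0 J) = dim (insert (b j0) (insert 0 (a ` J \<union> b ` J)))"
      using True by (intro arg_cong[where f=dim]) auto
    also have "\<dots> \<le> dim (a ` J \<union> b ` J) + 1"
      by (simp add: dim_insert span_insert_0 span_zero)
    finally show ?thesis
      using IH insert.hyps by simp
  next
    case False
    then obtain i where i: "a j0 $ i \<noteq> 0"
      by (metis vec_eq_iff zero_index)
    define s where "s = a j0 $ i"
    have s: "s \<noteq> 0" using i by (simp add: s_def)
    \<comment> \<open>With these coefficients the \<open>i\<close>-th coordinates of
      \<open>a' j\<close> and \<open>b' j\<close> vanish: the pairs are projected along
      \<open>a j0\<close> onto a coordinate hyperplane.\<close>
    define \<alpha> \<beta> where "\<alpha> j = a j $ i / s" and "\<beta> j = b j $ i / s" for j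
    define a' b' where "a' j = a j - \<alpha> j *\<^sub>R a j0" and "b' j = b j - \<beta> j *\<^sub>R a j0" for j
    \<comment> \<open>This is the relation with first index \<open>i\<close>, divided by
      \<open>s\<close> and solved for \<open>b j0\<close>.\<close>
    have b0: "b j0 $ l = \<beta> j0 * a j0 $ l - (\<Sum>j\<in>J. \<alpha> j * b j $ l - \<beta> j * a j $ l)" for l
    proof -
      have "s * (\<beta> j0 * a j0 $ l - (\<Sum>j\<in>J. \<alpha> j * b j $ l - \<beta> j * a j $ l)) =
        b j0 $ i * a j0 $ l - (\<Sum>j\<in>J. a j $ i * b j $ l - b j $ i * a j $ l)"
        using s by (simp add: right_diff_distrib sum_distrib_left \<alpha>_def \<beta>_def)
      also have "\<dots> = s * b j0 $ l"
        using rel[of i l] by (simp add: s_def)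
      finally show ?thesis using s by simp
    qed
    \<comment> \<open>Passing to \<open>a'\<close>, \<open>b'\<close> changes the sum by a multiple
      of \<open>a j0\<close> wedged with the sum in \<open>b0\<close>; by \<open>b0\<close> this
      change is exactly the missing term of the pair \<open>j0\<close>.\<close>
    have "(\<Sum>j\<in>J. a' j $ k * b' j $ l - b' j $ k * a' j $ l) = 0" for k l
    proof -
      have "(\<Sum>j\<in>J. a' j $ k * b' j $ l - b' j $ k * a' j $ l) =
        (\<Sum>j\<in>J. (a j $ k * b j $ l - b j $ k * a j $ l)
           - a j0 $ k * (\<alpha> j * b j $ l - \<beta> j * a j $ l)
           + a j0 $ l * (\<alpha> j * b j $ k - \<beta> j * a j $ k))"
        by (intro sum.cong) (auto simp: a'_def b'_def algebra_simps)
      also have "\<dots> = (\<Sum>j\<in>J. a j $ k * b j $ l - b j $ k * a j $ l)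
           - a j0 $ k * (\<Sum>j\<in>J. \<alpha> j * b j $ l - \<beta> j * a j $ l)
           + a j0 $ l * (\<Sum>j\<in>J. \<alpha> j * b j $ k - \<beta> j * a j $ k)"
        unfolding sum_distrib_left sum.distrib[symmetric] sum_subtractf[symmetric] ..
      also have "\<dots> = (\<Sum>j\<in>J. a j $ k * b j $ l - b j $ k * a j $ l)
           + a j0 $ k * b j0 $ l - b j0 $ k * a j0 $ l"
      proof -
        have T: "(\<Sum>j\<in>J. \<alpha> j * b j $ l - \<beta> j * a j $ l) = \<beta> j0 * a j0 $ l - b j0 $ l" for l
          using b0[of l] by linarith
        show ?thesis unfolding T by (simp add: algebra_simps)
      qed
      also have "\<dots> = 0" using rel[of k l] by simp
      finally show ?thesis .
    qed
    then have IH: "dim (a' ` J \<union> b' ` J) \<le> card J"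
      by (rule insert.IH)
    let ?S = "span (insert (a j0) (a' ` J \<union> b' ` J))"
    have a0: "a j0 \<in> ?S" by (simp add: span_base)
    have aJ: "a j \<in> ?S" if "j \<in> J" for j
    proof -
      have "a' j + \<alpha> j *\<^sub>R a j0 \<in> ?S"
        using that by (intro span_add span_scale a0 span_base) auto
      then show ?thesis by (simp add: a'_def)
    qed
    have bJ: "b j \<in> ?S" if "j \<in> J" for j
    proof -
      have "b' j + \<beta> j *\<^sub>R a j0 \<in> ?S"
        using that by (intro span_add span_scale a0 span_base) auto
      then show ?thesis by (simp add: b'_def)
    qed
    have "b j0 = \<beta> j0 *\<^sub>R a j0 - (\<Sum>j\<in>J. \<alpha> j *\<^sub>R b j - \<beta> j *\<^sub>R a j)"
      unfolding vec_eq_iff using b0 by simp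
    moreover have "\<beta> j0 *\<^sub>R a j0 - (\<Sum>j\<in>J. \<alpha> j *\<^sub>R b j - \<beta> j *\<^sub>R a j) \<in> ?S"
      by (intro span_diff span_scale a0 span_sum aJ bJ)
    ultimately have bj0: "b j0 \<in> ?S" by metis
    have "a ` insert j0 J \<union> b ` insert j0 J \<subseteq> ?S"
      using a0 aJ bJ bj0 by blast
    then have "dim (a ` insert j0 J \<union> b ` insert j0 J) \<le> dim ?S"
      by (rule dim_subset)
    also have "\<dots> \<le> dim (a' ` J \<union> b' ` J) + 1"
      by (simp add: dim_insert)
    finally show ?thesis
      using IH insert.hyps by simp
  qed
qed

section \<open>Smooth functions\<close>

text \<open>One fixed choice of partial derivatives for each member of \<open>S\<close>, again in
  \<open>S\<close>, can be iterated along the index list. Smoothness thus reduces to exhibiting a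
  class closed under first partial derivatives.\<close>

lemma smooth_fun_coinduct:
  fixes S :: "(real^'m \<Rightarrow> real) set"
  assumes "\<phi> \<in> S"
    and step: "\<And>g. g \<in> S \<Longrightarrow>
      \<exists>G. (\<forall>i. G i \<in> S) \<and> (\<forall>x. (g has_derivative (\<lambda>h. \<Sum>i\<in>UNIV. h $ i * G i x)) (at x))"
  shows "smooth_fun \<phi>"
proof -
  from step have "\<forall>g\<in>S. \<exists>G. (\<forall>i. G i \<in> S) \<and>
      (\<forall>x. (g has_derivative (\<lambda>h. \<Sum>i\<in>UNIV. h $ i * G i x)) (at x))" by blast
  from bchoice[OF this] obtain \<Gamma> where "\<forall>g\<in>S. (\<forall>i. \<Gamma> g i \<in> S) \<and>
      (\<forall>x. (g has_derivative (\<lambda>h. \<Sum>i\<in>UNIV. h $ i * \<Gamma> g i x)) (at x))" ..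
  then have \<Gamma>: "\<And>g i. g \<in> S \<Longrightarrow> \<Gamma> g i \<in> S"
    "\<And>g x. g \<in> S \<Longrightarrow> (g has_derivative (\<lambda>h. \<Sum>i\<in>UNIV. h $ i * \<Gamma> g i x)) (at x)"
    by blast+
  define D where "D ks = rec_list \<phi> (\<lambda>i ks g. \<Gamma> g i) ks" for ks
  have D: "D [] = \<phi>" "D (i # ks) = \<Gamma> (D ks) i" for i ks
    by (simp_all add: D_def)
  have "D ks \<in> S" for ks
    by (induction ks) (auto simp: D assms(1) \<Gamma>(1))
  then show ?thesis
    unfolding smooth_fun_def using \<Gamma>(2) D by (intro exI[of _ D]) auto
qed

text \<open>The powers of \<open>1/t\<close> are what differentiating exp(-c/t) produces; with them
  as a parameter the family is closed under differentiation up to linear combinations.\<close>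

definition flat_exp :: "nat \<Rightarrow> real \<Rightarrow> real \<Rightarrow> real" where
  "flat_exp k c t = (if t > 0 then inverse t ^ k * exp (- (c / t)) else 0)"

text \<open>From the right, \<open>y = 1/t\<close> turns this into the decay of
  \<open>y^k exp(-c y)\<close> at infinity. The same limit gives differentiability at 0, since every
  negative power of \<open>t\<close> is covered.\<close>

lemma flat_exp_limit:
  assumes "c > 0"
  shows "((\<lambda>t. flat_exp k c t) \<longlongrightarrow> 0) (at 0)"
proof -
  have "((\<lambda>y. (c * y) ^ k / exp (c * y)) \<longlongrightarrow> 0) at_top"
    by (rule filterlim_compose[OF tendsto_power_div_exp_0])
       (use assms in \<open>auto intro!: filterlim_tendsto_pos_mult_at_top filterlim_ident\<close>)
  then have "((\<lambda>y. (1/c^k) * ((c * y) ^ k / exp (c * y))) \<longlongrightarrow> (1/c^k) * 0) at_top"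
    by (intro tendsto_intros)
  then have "((\<lambda>y. y ^ k * exp (- (c * y))) \<longlongrightarrow> 0) at_top"
    using assms by (simp add: power_mult_distrib exp_minus field_simps)
  then have "((\<lambda>t. inverse t ^ k * exp (- (c * inverse t))) \<longlongrightarrow> 0) (at_right 0)"
    by (rule filterlim_compose) (rule filterlim_inverse_at_top_right)
  then have "((\<lambda>t. flat_exp k c t) \<longlongrightarrow> 0) (at_right 0)"
    by (rule Lim_transform_eventually)
       (auto simp: flat_exp_def eventually_at_filter field_simps)
  moreover have "((\<lambda>t. flat_exp k c t) \<longlongrightarrow> 0) (at_left 0)"
    by (rule Lim_transform_eventually[OF tendsto_const[of 0]])
       (auto simp: flat_exp_def eventually_at_filter)
  ultimately show ?thesis
    by (simp add: filterlim_split_at)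
qed

lemma flat_exp_has_derivative:
  assumes "c > 0"
  shows "(flat_exp k c has_real_derivative
     (- real k) * flat_exp (Suc k) c t + c * flat_exp (Suc (Suc k)) c t) (at t)"
proof (cases t "0::real" rule: linorder_cases)
  case less
  have "((\<lambda>_. 0) has_real_derivative 0) (at t)" by simp
  then have "(flat_exp k c has_real_derivative 0) (at t)"
    by (rule has_field_derivative_transform_within_open[where S="{..<0}"])
       (use less in \<open>auto simp: flat_exp_def\<close>)
  then show ?thesis using less by (simp add: flat_exp_def)
next
  case equal
  \<comment> \<open>The difference quotient at 0 is \<open>flat_exp (Suc k) c\<close>
    itself.\<close>
  have "((\<lambda>h. (flat_exp k c (0 + h) - flat_exp k c 0) / h) \<longlongrightarrow> 0) (at 0)"
    by (rule Lim_transform_eventually[OF flat_exp_limit[OF assms, of "Suc k"]])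
       (auto simp: flat_exp_def eventually_at_filter field_simps)
  then show ?thesis using equal by (simp add: DERIV_def flat_exp_def)
next
  case greater
  have "((\<lambda>t. inverse t ^ k * exp (- (c / t))) has_real_derivative
    (- real k) * flat_exp (Suc k) c t + c * flat_exp (Suc (Suc k)) c t) (at t)"
  proof -
    have 1: "((\<lambda>t. inverse t ^ k) has_real_derivative - real k * inverse t ^ Suc k) (at t)"
      by (rule DERIV_cong[OF DERIV_power[OF DERIV_inverse]])
         (use greater in \<open>cases k; simp add: field_simps power2_eq_square\<close>)+
    have "((\<lambda>t. - (c / t)) has_real_derivative c * inverse t ^ 2) (at t)"
      using greater by (auto intro!: derivative_eq_intros simp: field_simps power2_eq_square)
    then have 2: "((\<lambda>t. exp (- (c / t))) has_real_derivative exp (- (c / t)) * (c * inverse t ^ 2)) (at t)"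
      by (rule DERIV_chain2[OF DERIV_exp])
    show ?thesis
      by (rule DERIV_cong[OF DERIV_mult[OF 1 2]])
         (use greater in \<open>simp add: flat_exp_def power2_eq_square\<close>)
  qed
  then show ?thesis
    by (rule has_field_derivative_transform_within_open[where S="{0<..}"])
       (use greater in \<open>auto simp: flat_exp_def\<close>)
qed

text \<open>Closure under primitives keeps averages of bump functions along a coordinate line among the
  test functions.\<close>
inductive_set smooth1 :: "(real \<Rightarrow> real) set" where
  const: "(\<lambda>_. c) \<in> smooth1"
| flat: "c > 0 \<Longrightarrow> (\<lambda>t. flat_exp k c (\<sigma> * t + a)) \<in> smooth1"
| add: "f \<in> smooth1 \<Longrightarrow> g \<in> smooth1 \<Longrightarrow> (\<lambda>t. f t + g t) \<in> smooth1"
| mult: "f \<in> smooth1 \<Longrightarrow> g \<in> smooth1 \<Longrightarrow> (\<lambda>t. f t * g t) \<in> smooth1"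
| shift: "f \<in> smooth1 \<Longrightarrow> (\<lambda>t. f (t - a)) \<in> smooth1"
| primitive: "f \<in> smooth1 \<Longrightarrow> (\<And>t. (F has_real_derivative f t) (at t)) \<Longrightarrow> F \<in> smooth1"

lemma smooth1_derivative:
  assumes "f \<in> smooth1"
  shows "\<exists>f'\<in>smooth1. \<forall>t. (f has_real_derivative f' t) (at t)"
  using assms
proof induction
  case (const c)
  show ?case by (rule bexI[of _ "\<lambda>_. 0"]) (auto intro: smooth1.const)
next
  case (flat c k \<sigma> a)
  let ?f = "\<lambda>t. \<sigma> * ((- real k) * flat_exp (Suc k) c (\<sigma> * t + a) + c * flat_exp (Suc (Suc k)) c (\<sigma> * t + a))"
  have "?f \<in> smooth1"
    by (intro smooth1.mult smooth1.add smooth1.const smooth1.flat flat)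
  moreover have "((\<lambda>t. flat_exp k c (\<sigma> * t + a)) has_real_derivative ?f t) (at t)" for t
    by (rule DERIV_cong[OF DERIV_chain2[OF flat_exp_has_derivative[OF flat]]])
       (auto intro!: derivative_eq_intros)
  ultimately show ?case by (intro bexI[of _ ?f]) auto
next
  case (add f g)
  then obtain f' g' where "f' \<in> smooth1" "\<forall>t. (f has_real_derivative f' t) (at t)"
    "g' \<in> smooth1" "\<forall>t. (g has_real_derivative g' t) (at t)" by auto
  then show ?case
    by (intro bexI[of _ "\<lambda>t. f' t + g' t"]) (auto intro!: smooth1.add derivative_intros)
next
  case (mult f g)
  then obtain f' g' where "f' \<in> smooth1" "\<forall>t. (f has_real_derivative f' t) (at t)"
    "g' \<in> smooth1" "\<forall>t. (g has_real_derivative g' t) (at t)" by auto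
  with mult.hyps show ?case
    by (intro bexI[of _ "\<lambda>t. f' t * g t + g' t * f t"])
       (auto intro!: smooth1.add smooth1.mult DERIV_mult)
next
  case (shift f a)
  then obtain f' where f': "f' \<in> smooth1" "\<And>t. (f has_real_derivative f' t) (at t)" by auto
  have "((\<lambda>t. f (t - a)) has_real_derivative f' (t - a)) (at t)" for t
    using DERIV_shift[of f "f' (t - a)" t "- a"] f'(2)[of "t - a"] by simp
  with f'(1) show ?case
    by (intro bexI[of _ "\<lambda>t. f' (t - a)"]) (auto intro: smooth1.shift)
next
  case (primitive f F)
  then show ?case by blast
qed

text \<open>All test functions used live on boxes, so sums and products of one-variable functions
  suffice; this class is closed under partial derivatives, as \<open>smooth_fun_coinduct\<close>
  demands.\<close>

inductive_set coord_smooth :: "(real^'m \<Rightarrow> real) set" where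
  coord: "q \<in> smooth1 \<Longrightarrow> (\<lambda>x. q (x $ i)) \<in> coord_smooth"
| add: "f \<in> coord_smooth \<Longrightarrow> g \<in> coord_smooth \<Longrightarrow> (\<lambda>x. f x + g x) \<in> coord_smooth"
| mult: "f \<in> coord_smooth \<Longrightarrow> g \<in> coord_smooth \<Longrightarrow> (\<lambda>x. f x * g x) \<in> coord_smooth"

lemma coord_smooth_derivative:
  fixes f :: "real^'m \<Rightarrow> real"
  assumes "f \<in> coord_smooth"
  shows "\<exists>G. (\<forall>i. G i \<in> coord_smooth) \<and>
    (\<forall>x. (f has_derivative (\<lambda>h. \<Sum>i\<in>UNIV. h $ i * G i x)) (at x))"
  using assms
proof induction
  case (coord q i)
  obtain q' where q': "q' \<in> smooth1" "\<And>t. (q has_real_derivative q' t) (at t)"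
    using smooth1_derivative[OF coord] by auto
  define G :: "'m \<Rightarrow> real^'m \<Rightarrow> real" where "G l = (if l = i then (\<lambda>x. q' (x $ i)) else (\<lambda>x. 0))" for l
  have "(\<lambda>x::real^'m. 0) \<in> coord_smooth"
    using coord_smooth.coord[OF smooth1.const[of 0]] by simp
  then have "G l \<in> coord_smooth" for l
    using coord_smooth.coord[OF q'(1), where i=i] by (simp add: G_def)
  moreover have "((\<lambda>x::real^'m. q (x $ i)) has_derivative (\<lambda>h. \<Sum>l\<in>UNIV. h $ l * G l x)) (at x)" for x
  proof -
    have eq: "(\<Sum>l\<in>UNIV. h $ l * G l x) = q' (x $ i) * h $ i" for h :: "real^'m"
    proof -
      have "(\<Sum>l\<in>UNIV. h $ l * G l x) = (\<Sum>l\<in>UNIV. if l = i then h $ i * q' (x $ i) else 0)"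
        by (intro sum.cong) (auto simp: G_def)
      then show ?thesis by simp
    qed
    show ?thesis unfolding eq
      by (rule has_derivative_compose[OF _ q'(2)[unfolded has_field_derivative_def]])
         (rule bounded_linear_imp_has_derivative[OF bounded_linear_vec_nth])
  qed
  ultimately show ?case by blast
next
  case (add f g)
  then obtain F G where "\<forall>i. F i \<in> coord_smooth" "\<forall>i. G i \<in> coord_smooth"
    "\<And>x. (f has_derivative (\<lambda>h. \<Sum>i\<in>UNIV. h $ i * F i x)) (at x)"
    "\<And>x. (g has_derivative (\<lambda>h. \<Sum>i\<in>UNIV. h $ i * G i x)) (at x)" by auto
  note FG = this
  have "((\<lambda>x. f x + g x) has_derivative (\<lambda>h. \<Sum>i\<in>UNIV. h $ i * (F i x + G i x))) (at x)" for x
    using has_derivative_add[OF FG(3,4)[of x]] by (simp add: distrib_left sum.distrib)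
  with FG(1,2) show ?case
    by (intro exI[of _ "\<lambda>i x. F i x + G i x"]) (auto intro: coord_smooth.add)
next
  case (mult f g)
  then obtain F G where "\<forall>i. F i \<in> coord_smooth" "\<forall>i. G i \<in> coord_smooth"
    "\<And>x. (f has_derivative (\<lambda>h. \<Sum>i\<in>UNIV. h $ i * F i x)) (at x)"
    "\<And>x. (g has_derivative (\<lambda>h. \<Sum>i\<in>UNIV. h $ i * G i x)) (at x)" by auto
  note FG = this
  let ?H = "\<lambda>i x. f x * G i x + F i x * g x"
  have "((\<lambda>x. f x * g x) has_derivative (\<lambda>h. \<Sum>i\<in>UNIV. h $ i * ?H i x)) (at x)" for x
  proof -
    have "(\<lambda>h. f x * (\<Sum>i\<in>UNIV. h $ i * G i x) + (\<Sum>i\<in>UNIV. h $ i * F i x) * g x)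
       = (\<lambda>h. \<Sum>i\<in>UNIV. h $ i * ?H i x)"
      unfolding sum_distrib_left sum_distrib_right sum.distrib[symmetric]
      by (intro ext sum.cong) (auto simp: algebra_simps)
    with has_derivative_mult[OF FG(3,4)[of x]] show ?thesis by simp
  qed
  moreover have "?H i \<in> coord_smooth" for i
    using FG(1,2) mult.hyps by (intro coord_smooth.add coord_smooth.mult) auto
  ultimately show ?case by (intro exI[of _ ?H]) auto
qed

lemma coord_smooth_smooth_fun: "f \<in> coord_smooth \<Longrightarrow> smooth_fun f"
  by (rule smooth_fun_coinduct[OF _ coord_smooth_derivative])

lemma coord_smooth_prod:
  assumes "finite I" "\<And>i. i \<in> I \<Longrightarrow> q i \<in> smooth1"
  shows "(\<lambda>x::real^'m. \<Prod>i\<in>I. q i (x $ i)) \<in> coord_smooth"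
  using assms
proof (induction I rule: finite_induct)
  case empty
  show ?case using coord_smooth.coord[OF smooth1.const[of 1]] by simp
next
  case (insert i I)
  have "(\<lambda>x::real^'m. q i (x $ i) * (\<Prod>i\<in>I. q i (x $ i))) \<in> coord_smooth"
    using insert by (intro coord_smooth.mult coord_smooth.coord) auto
  then show ?case using insert by simp
qed

section \<open>Translations in Lebesgue spaces\<close>

lemma integral_lborel_shift:
  fixes f :: "'a::euclidean_space \<Rightarrow> real"
  assumes [measurable]: "f \<in> borel_measurable borel"
  shows "(\<integral>x. f (x + h) \<partial>lborel) = (\<integral>x. f x \<partial>lborel)"
proof -
  have "(\<integral>x. f x \<partial>lborel) = (\<integral>x. f x \<partial>(distr lborel borel ((+) h)))"
    by (simp add: lborel_distr_plus)
  also have "\<dots> = (\<integral>x. f (h + x) \<partial>lborel)"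
    by (rule integral_distr) auto
  finally show ?thesis by (simp add: add.commute)
qed

lemma integrable_lborel_shift:
  fixes f :: "'a::euclidean_space \<Rightarrow> real"
  assumes "integrable lborel f"
  shows "integrable lborel (\<lambda>x. f (x + h))"
proof -
  have "integrable (distr lborel borel ((+) h)) f"
    using assms by (simp add: lborel_distr_plus)
  then have "integrable lborel (\<lambda>x. f (h + x))"
    by (rule integrable_distr[rotated]) auto
  then show ?thesis by (simp add: add.commute)
qed

lemma AE_lborel_shift:
  fixes h :: "'a::euclidean_space" and P :: "'a \<Rightarrow> bool"
  assumes "AE x in lborel. P x"
  shows "AE x in lborel. P (x + h)"
proof -
  have "AE x in distr lborel borel ((+) h). P x"
    using assms by (subst lborel_distr_plus)
  then have "AE x in lborel. P (h + x)"
    by (rule AE_distrD[rotated]) auto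
  then show ?thesis by (simp add: add.commute)
qed

text \<open>Every translate of a null set is null, so for each \<open>s\<close> almost every
  \<open>x\<close> is good; Fubini exchanges the two quantifiers.\<close>

lemma AE_lborel_line:
  fixes e :: "'a::euclidean_space" and P :: "'a \<Rightarrow> bool"
  assumes "AE x in lborel. P x"
  shows "AE x in lborel. AE s in lborel. P (x + s *\<^sub>R e)"
proof -
  \<comment> \<open>The exchange needs a product-measurable set, so \<open>P\<close> is replaced by
    the complement of a Borel null set.\<close>
  obtain N where N: "N \<in> null_sets lborel" "{x \<in> space lborel. \<not> P x} \<subseteq> N"
    using assms by (auto simp: eventually_ae_filter)
  have [measurable]: "N \<in> sets borel" using N(1) by auto
  have "AE s in lborel. AE x in lborel. x + s *\<^sub>R e \<notin> N"
    by (intro AE_I2 AE_lborel_shift AE_not_in N)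
  then have "AE x in lborel. AE s in lborel. x + s *\<^sub>R e \<notin> N"
  proof (subst lborel_pair.AE_commute)
    have "(\<lambda>p. snd p *\<^sub>R e + fst p) -` N \<inter> space (lborel \<Otimes>\<^sub>M lborel) \<in> sets (lborel \<Otimes>\<^sub>M lborel)"
      by (rule measurable_sets[where A=borel]) (auto intro!: borel_measurable_add borel_measurable_scaleR)
    then have "space (lborel \<Otimes>\<^sub>M lborel) - (\<lambda>p. snd p *\<^sub>R e + fst p) -` N \<inter> space (lborel \<Otimes>\<^sub>M lborel) \<in> sets (lborel \<Otimes>\<^sub>M lborel)"
      by (rule sets.compl_sets)
    then show "{p \<in> space (lborel \<Otimes>\<^sub>M lborel). fst p + snd p *\<^sub>R e \<notin> N} \<in> sets (lborel \<Otimes>\<^sub>M lborel)"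
      by (rule back_subst[of "\<lambda>A. A \<in> sets (lborel \<Otimes>\<^sub>M lborel)"]) (auto simp: add.commute)
  qed
  then show ?thesis
  proof eventually_elim
    case (elim x)
    then show ?case by eventually_elim (use N(2) in auto)
  qed
qed

text \<open>By translation invariance each slice in \<open>x\<close> has integral at most
  \<open>B\<close> times the \<open>L^1\<close> norm of \<open>v\<close>, uniformly in
  \<open>s\<close>. This licenses the exchanges of integration along a segment with integration over
  space.\<close>

lemma integrable_line_pair:
  fixes v \<phi> :: "'a::euclidean_space \<Rightarrow> real"
  assumes v: "integrable lborel v" and [measurable]: "\<phi> \<in> borel_measurable borel"
    and \<phi>: "\<And>x. \<bar>\<phi> x\<bar> \<le> B"
  shows "integrable (lborel \<Otimes>\<^sub>M lborel) (\<lambda>(s, x). indicator {0..t} s * (v (x + s *\<^sub>R e) * \<phi> x))"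
proof (rule lborel_pair.Fubini_integrable)
  have [measurable]: "v \<in> borel_measurable borel" using v by auto
  show meas: "(\<lambda>(s, x). indicator {0..t} s * (v (x + s *\<^sub>R e) * \<phi> x)) \<in> borel_measurable (lborel \<Otimes>\<^sub>M lborel)"
    by measurable
  have int: "integrable lborel (\<lambda>x. v (x + s *\<^sub>R e) * \<phi> x)" for s
    by (rule Bochner_Integration.integrable_bound[where f="\<lambda>x. v (x + s *\<^sub>R e) * B"])
       (use integrable_lborel_shift[OF v, of "s *\<^sub>R e"] \<phi> in
         \<open>auto simp: abs_mult intro!: mult_left_mono order_trans[OF \<phi> abs_ge_self]\<close>)
  show "AE s in lborel. integrable lborel (\<lambda>x. case (s, x) of (s, x) \<Rightarrow> indicator {0..t} s * (v (x + s *\<^sub>R e) * \<phi> x))"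
    using int by (intro AE_I2) simp
  have B: "0 \<le> B" using \<phi>[of 0] by linarith
  show "integrable lborel (\<lambda>s. \<integral>x. norm (case (s, x) of (s, x) \<Rightarrow> indicator {0..t} s * (v (x + s *\<^sub>R e) * \<phi> x)) \<partial>lborel)"
  proof (rule Bochner_Integration.integrable_bound[where f="\<lambda>s. indicator {0..t} s * (B * (\<integral>x. \<bar>v x\<bar> \<partial>lborel))"])
    show "integrable lborel (\<lambda>s. indicator {0..t} s * (B * (\<integral>x. \<bar>v x\<bar> \<partial>lborel)))"
      by (cases "0 \<le> t") auto
    show "(\<lambda>s. \<integral>x. norm (case (s, x) of (s, x) \<Rightarrow> indicator {0..t} s * (v (x + s *\<^sub>R e) * \<phi> x)) \<partial>lborel)
      \<in> borel_measurable lborel" by measurable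
    have "(\<integral>x. \<bar>v (x + s *\<^sub>R e) * \<phi> x\<bar> \<partial>lborel) \<le> B * (\<integral>x. \<bar>v x\<bar> \<partial>lborel)" for s
    proof -
      have "(\<integral>x. \<bar>v (x + s *\<^sub>R e) * \<phi> x\<bar> \<partial>lborel) \<le> (\<integral>x. B * \<bar>v (x + s *\<^sub>R e)\<bar> \<partial>lborel)"
        using integrable_lborel_shift[OF v, of "s *\<^sub>R e"] int[of s] \<phi>
        by (intro integral_mono integrable_abs) (auto simp: abs_mult mult.commute[of B] intro!: mult_left_mono)
      also have "\<dots> = B * (\<integral>x. \<bar>v x\<bar> \<partial>lborel)"
        using integral_lborel_shift[of "\<lambda>x. \<bar>v x\<bar>" "s *\<^sub>R e"] by simp
      finally show ?thesis .
    qed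
    then show "AE s in lborel. norm (\<integral>x. norm (case (s, x) of (s, x) \<Rightarrow> indicator {0..t} s * (v (x + s *\<^sub>R e) * \<phi> x)) \<partial>lborel)
       \<le> norm (indicator {0..t} s * (B * (\<integral>x. \<bar>v x\<bar> \<partial>lborel)))"
      using B by (intro AE_I2) (auto simp: abs_mult split: split_indicator)
  qed
qed

lemma integrable_line_pair1:
  fixes v :: "'a::euclidean_space \<Rightarrow> real"
  assumes v: "integrable lborel v"
  shows "integrable (lborel \<Otimes>\<^sub>M lborel) (\<lambda>(s, x). indicator {0..t} s * v (x + s *\<^sub>R e))"
  using integrable_line_pair[OF v, of "\<lambda>_. 1" 1] by simp

text \<open>Open boxes form an intersection-stable generator of the Borel sets. The vanishing total
  integral serves the complement step, as the whole space is not a box.\<close>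

lemma AE_zero_if_box_integrals_zero:
  fixes g :: "'a::euclidean_space \<Rightarrow> real"
  assumes g: "integrable lborel g"
    and box: "\<And>c d. (\<integral>x. indicator (box c d) x * g x \<partial>lborel) = 0"
    and total: "(\<integral>x. g x \<partial>lborel) = 0"
  shows "AE x in lborel. g x = 0"
proof -
  have [measurable]: "g \<in> borel_measurable borel" using g by auto
  have zero: "(\<integral>x. indicator A x * g x \<partial>lborel) = 0" if "A \<in> sets borel" for A
  proof -
    have sets: "sets borel = sigma_sets UNIV (range (\<lambda>(a, b). box a b :: 'a set))"
      by (subst borel_eq_box) simp
    show ?thesis
    proof (rule sigma_sets_induct_disjoint[OF _ _ that[unfolded sets]], goal_cases)
      case 1
      show ?case by (auto simp: Int_stable_def box_Int_box)
    next
      case 2 then show ?case by simp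
    next
      case (3 A)
      then show ?case using box by auto
    next
      case 4
      show ?case by simp
    next
      case (5 A)
      then have [measurable]: "A \<in> sets borel" unfolding sets by simp
      have i: "integrable lborel (\<lambda>x. indicator A x * g x)"
        using integrable_real_mult_indicator[OF _ g, of A] by (simp add: mult.commute)
      have "(\<integral>x. indicator (UNIV - A) x * g x \<partial>lborel) = (\<integral>x. g x - indicator A x * g x \<partial>lborel)"
        by (intro Bochner_Integration.integral_cong) (auto split: split_indicator)
      also have "\<dots> = 0" using g i total 5 by simp
      finally show ?case .
    next
      case (6 A)
      then have A[measurable]: "\<And>i. A i \<in> sets borel" unfolding sets by auto
      have "(\<integral>x\<in>(\<Union>i. A i). g x \<partial>lborel) = (\<Sum>i. \<integral>x\<in>A i. g x \<partial>lborel)"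
      proof (rule lebesgue_integral_countable_add)
        show "set_integrable lborel (\<Union>i. A i) g"
          unfolding set_integrable_def by (rule integrable_mult_indicator) (use g in auto)
      qed (use 6 A in \<open>auto simp: disjoint_family_on_def\<close>)
      then show ?case using 6 by (simp add: set_lebesgue_integral_def)
    qed
  qed
  have "AE x in lborel. g x = (\<lambda>_. 0) x"
    by (rule density_unique_real) (use g zero in \<open>auto simp: set_lebesgue_integral_def\<close>)
  then show ?thesis by simp
qed

section \<open>Continuity of translations in \<open>L^1\<close>\<close>

text \<open>Translation preserves the \<open>L^1\<close> distance between \<open>v\<close> and
  \<open>g\<close>, so the approximation error is paid twice and the shift of \<open>g\<close>
  once.\<close>

lemma L1_shift_approx:
  fixes v :: "'a::euclidean_space \<Rightarrow> real"
  assumes v: "integrable lborel v"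
    and approx: "\<And>\<epsilon>. \<epsilon> > 0 \<Longrightarrow> \<exists>g. integrable lborel g \<and> (\<integral>x. \<bar>v x - g x\<bar> \<partial>lborel) < \<epsilon> \<and>
       (\<lambda>n. \<integral>x. \<bar>g (x + h n) - g x\<bar> \<partial>lborel) \<longlonglongrightarrow> 0"
  shows "(\<lambda>n. \<integral>x. \<bar>v (x + h n) - v x\<bar> \<partial>lborel) \<longlonglongrightarrow> 0"
proof (rule LIMSEQ_I)
  fix \<epsilon> :: real assume "\<epsilon> > 0"
  then obtain g where g: "integrable lborel g" "(\<integral>x. \<bar>v x - g x\<bar> \<partial>lborel) < \<epsilon>/3"
    "(\<lambda>n. \<integral>x. \<bar>g (x + h n) - g x\<bar> \<partial>lborel) \<longlonglongrightarrow> 0"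
    using approx[of "\<epsilon>/3"] by auto
  have [measurable]: "g \<in> borel_measurable borel" "v \<in> borel_measurable borel" using g v by auto
  obtain N where N: "\<And>n. n \<ge> N \<Longrightarrow> \<bar>\<integral>x. \<bar>g (x + h n) - g x\<bar> \<partial>lborel\<bar> < \<epsilon>/3"
    using LIMSEQ_D[OF g(3), of "\<epsilon>/3"] \<open>\<epsilon> > 0\<close> by auto
  have "(\<integral>x. \<bar>v (x + h n) - v x\<bar> \<partial>lborel) < \<epsilon>" if "n \<ge> N" for n
  proof -
    have "(\<integral>x. \<bar>v (x + h n) - v x\<bar> \<partial>lborel) \<le>
      (\<integral>x. \<bar>v (x + h n) - g (x + h n)\<bar> + \<bar>g (x + h n) - g x\<bar> + \<bar>v x - g x\<bar> \<partial>lborel)"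
      using v g(1) integrable_lborel_shift[OF v, of "h n"] integrable_lborel_shift[OF g(1), of "h n"]
      by (intro integral_mono) auto
    also have "\<dots> = (\<integral>x. \<bar>v (x + h n) - g (x + h n)\<bar> \<partial>lborel) + (\<integral>x. \<bar>g (x + h n) - g x\<bar> \<partial>lborel)
       + (\<integral>x. \<bar>v x - g x\<bar> \<partial>lborel)"
      using v g(1) integrable_lborel_shift[OF v, of "h n"] integrable_lborel_shift[OF g(1), of "h n"]
      by simp
    also have "(\<integral>x. \<bar>v (x + h n) - g (x + h n)\<bar> \<partial>lborel) = (\<integral>x. \<bar>v x - g x\<bar> \<partial>lborel)"
      by (rule integral_lborel_shift[of "\<lambda>x. \<bar>v x - g x\<bar>"]) measurable
    finally show ?thesis using g(2) N[OF that] by linarith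
  qed
  then show "\<exists>N. \<forall>n\<ge>N. norm ((\<integral>x. \<bar>v (x + h n) - v x\<bar> \<partial>lborel) - 0) < \<epsilon>"
    by (intro exI[of _ N]) (auto simp: abs_of_nonneg)
qed

text \<open>For an open set of finite measure only the points that leave it matter, because both sides
  of the symmetric difference with a translate have the same measure.\<close>
lemma L1_shift_open:
  fixes U :: "'a::euclidean_space set"
  assumes "open U" "emeasure lborel U < \<infinity>" and h: "h \<longlonglongrightarrow> 0"
  shows "(\<lambda>n. \<integral>x. \<bar>indicator U (x + h n) - indicator U x :: real\<bar> \<partial>lborel) \<longlonglongrightarrow> 0"
proof -
  have [measurable]: "U \<in> sets borel" using assms by auto
  let ?I = "\<lambda>x. indicator U x :: real"
  have I: "integrable lborel ?I" using assms by auto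
  have Ih: "integrable lborel (\<lambda>x. ?I (x + h n))" for n
    by (rule integrable_lborel_shift[OF I])
  have prod: "integrable lborel (\<lambda>x. ?I x * (1 - ?I (x + h n)))" for n
    by (rule Bochner_Integration.integrable_bound[OF I]) (auto split: split_indicator)
  have eq: "(\<integral>x. \<bar>?I (x + h n) - ?I x\<bar> \<partial>lborel) = 2 * (\<integral>x. ?I x * (1 - ?I (x + h n)) \<partial>lborel)" for n
  proof -
    have "(\<integral>x. \<bar>?I (x + h n) - ?I x\<bar> \<partial>lborel) =
      (\<integral>x. 2 * (?I x * (1 - ?I (x + h n))) + (?I (x + h n) - ?I x) \<partial>lborel)"
      by (intro Bochner_Integration.integral_cong) (auto split: split_indicator)
    also have "\<dots> = 2 * (\<integral>x. ?I x * (1 - ?I (x + h n)) \<partial>lborel)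
       + ((\<integral>x. ?I (x + h n) \<partial>lborel) - (\<integral>x. ?I x \<partial>lborel))"
      by (simp only: Bochner_Integration.integral_add Bochner_Integration.integral_diff I Ih prod
          Bochner_Integration.integrable_diff integrable_mult_right integral_mult_right_zero)
    also have "(\<integral>x. ?I (x + h n) \<partial>lborel) = (\<integral>x. ?I x \<partial>lborel)"
      by (rule integral_lborel_shift) measurable
    finally show ?thesis by simp
  qed
  have "(\<lambda>n. \<integral>x. ?I x * (1 - ?I (x + h n)) \<partial>lborel) \<longlonglongrightarrow> integral\<^sup>L lborel (\<lambda>x::'a. 0)"
  proof (rule integral_dominated_convergence[where w = ?I])
    show "AE x in lborel. (\<lambda>n. ?I x * (1 - ?I (x + h n))) \<longlonglongrightarrow> 0"
    proof (rule AE_I2)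
      fix x
      show "(\<lambda>n. ?I x * (1 - ?I (x + h n))) \<longlonglongrightarrow> 0"
      proof (cases "x \<in> U")
        case True
        have "(\<lambda>n. x + h n) \<longlonglongrightarrow> x + 0" by (intro tendsto_intros h)
        then have "eventually (\<lambda>n. x + h n \<in> U) sequentially"
          using True assms(1) by (auto dest: topological_tendstoD)
        then have "\<forall>\<^sub>F n in sequentially. ?I x * (1 - ?I (x + h n)) = 0"
          by eventually_elim simp
        then show ?thesis by (rule tendsto_eventually)
      qed simp
    qed
  qed (use I in \<open>auto split: split_indicator\<close>)
  then have "(\<lambda>n. 2 * (\<integral>x. ?I x * (1 - ?I (x + h n)) \<partial>lborel)) \<longlonglongrightarrow> 2 * 0"
    by (intro tendsto_intros) simp
  then show ?thesis unfolding eq by simp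
qed

lemma L1_shift_tendsto_sequentially:
  fixes v :: "'a::euclidean_space \<Rightarrow> real"
  assumes v: "integrable lborel v" and h: "h \<longlonglongrightarrow> 0"
  shows "(\<lambda>n. \<integral>x. \<bar>v (x + h n) - v x\<bar> \<partial>lborel) \<longlonglongrightarrow> 0"
  using v
proof (induction rule: integrable_induct)
  case (base A c)
  then have [measurable]: "A \<in> sets borel" by simp
  have intA: "integrable lborel (indicator A :: 'a \<Rightarrow> real)" using base by auto
  show ?case
  proof (rule L1_shift_approx)
    show "integrable lborel (\<lambda>x. indicator A x *\<^sub>R c)" using intA by simp
    fix \<epsilon> :: real assume e: "\<epsilon> > 0"
    \<comment> \<open>The added 1 covers \<open>c = 0\<close> and makes the final inequality
      strict.\<close>
    define \<epsilon>' where "\<epsilon>' = \<epsilon> / (\<bar>c\<bar> + 1)"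
    have e': "\<epsilon>' > 0" using e by (simp add: \<epsilon>'_def)
    obtain U where U: "open U" "A \<subseteq> U" "emeasure lborel (U - A) < \<epsilon>'"
      using outer_regular_lborel[OF _ e', of A] by auto
    have [measurable]: "U \<in> sets borel" using U by auto
    have "emeasure lborel U = emeasure lborel A + emeasure lborel (U - A)"
      using U by (subst plus_emeasure) (auto simp: Un_absorb1)
    also have "\<dots> < \<infinity>" using base(2) U(3) by (auto simp: less_top[symmetric])
    finally have finU: "emeasure lborel U < \<infinity>" .
    have UA: "measure lborel (U - A) < \<epsilon>'"
    proof -
      have "emeasure lborel (U - A) = ennreal (measure lborel (U - A))"
        using U(3) by (intro emeasure_eq_ennreal_measure) auto
      then show ?thesis using U(3) by (simp add: ennreal_less_iff)
    qed
    have intU: "integrable lborel (indicator U :: 'a \<Rightarrow> real)" using finU by auto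
    show "\<exists>g. integrable lborel g \<and> (\<integral>x. \<bar>indicator A x *\<^sub>R c - g x\<bar> \<partial>lborel) < \<epsilon> \<and>
       (\<lambda>n. \<integral>x. \<bar>g (x + h n) - g x\<bar> \<partial>lborel) \<longlonglongrightarrow> 0"
    proof (intro exI[of _ "\<lambda>x. indicator U x * c"] conjI)
      show "integrable lborel (\<lambda>x. indicator U x * c)" using intU by simp
      have "(\<integral>x. \<bar>indicator A x *\<^sub>R c - indicator U x * c\<bar> \<partial>lborel) = (\<integral>x. \<bar>c\<bar> * indicator (U - A) x \<partial>lborel)"
        using U(2) by (intro Bochner_Integration.integral_cong) (auto split: split_indicator)
      also have "\<dots> = \<bar>c\<bar> * measure lborel (U - A)" by simp
      also have "\<dots> \<le> \<bar>c\<bar> * \<epsilon>'" using UA by (intro mult_left_mono) auto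
      also have "\<dots> < \<epsilon>" using e by (simp add: \<epsilon>'_def field_simps)
      finally show "(\<integral>x. \<bar>indicator A x *\<^sub>R c - indicator U x * c\<bar> \<partial>lborel) < \<epsilon>" .
      have "(\<lambda>n. \<bar>c\<bar> * (\<integral>x. \<bar>indicator U (x + h n) - indicator U x\<bar> \<partial>lborel)) \<longlonglongrightarrow> \<bar>c\<bar> * 0"
        by (intro tendsto_intros L1_shift_open U finU h)
      then show "(\<lambda>n. \<integral>x. \<bar>indicator U (x + h n) * c - indicator U x * c\<bar> \<partial>lborel) \<longlonglongrightarrow> 0"
        unfolding left_diff_distrib[symmetric] abs_mult by (simp add: mult.commute)
    qed
  qed
next
  case (add f g)
  have "(\<lambda>n. (\<integral>x. \<bar>f (x + h n) - f x\<bar> \<partial>lborel) + (\<integral>x. \<bar>g (x + h n) - g x\<bar> \<partial>lborel)) \<longlonglongrightarrow> 0 + 0"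
    by (intro tendsto_intros add.IH)
  then have lim: "(\<lambda>n. (\<integral>x. \<bar>f (x + h n) - f x\<bar> \<partial>lborel) + (\<integral>x. \<bar>g (x + h n) - g x\<bar> \<partial>lborel)) \<longlonglongrightarrow> 0" by simp
  show ?case
  proof (rule tendsto_sandwich[OF _ _ tendsto_const[of 0] lim])
    have "(\<integral>x. \<bar>f (x + h n) + g (x + h n) - (f x + g x)\<bar> \<partial>lborel) \<le>
       (\<integral>x. \<bar>f (x + h n) - f x\<bar> + \<bar>g (x + h n) - g x\<bar> \<partial>lborel)" for n
      using add.hyps integrable_lborel_shift[OF add.hyps(1), of "h n"] integrable_lborel_shift[OF add.hyps(2), of "h n"]
      by (intro integral_mono) auto
    also have "(\<integral>x. \<bar>f (x + h n) - f x\<bar> + \<bar>g (x + h n) - g x\<bar> \<partial>lborel) =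
       (\<integral>x. \<bar>f (x + h n) - f x\<bar> \<partial>lborel) + (\<integral>x. \<bar>g (x + h n) - g x\<bar> \<partial>lborel)" for n
      using add.hyps integrable_lborel_shift[OF add.hyps(1), of "h n"] integrable_lborel_shift[OF add.hyps(2), of "h n"]
      by simp
    finally show "\<forall>\<^sub>F n in sequentially. (\<integral>x. \<bar>f (x + h n) + g (x + h n) - (f x + g x)\<bar> \<partial>lborel) \<le>
       (\<integral>x. \<bar>f (x + h n) - f x\<bar> \<partial>lborel) + (\<integral>x. \<bar>g (x + h n) - g x\<bar> \<partial>lborel)" by simp
  qed simp
next
  case (lim f s)
  have [measurable]: "f \<in> borel_measurable borel" "\<And>i. s i \<in> borel_measurable borel" using lim by auto
  have conv: "(\<lambda>i. \<integral>x. \<bar>f x - s i x\<bar> \<partial>lborel) \<longlonglongrightarrow> integral\<^sup>L lborel (\<lambda>x::'a. 0)"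
  \<comment> \<open>The approximants satisfy \<open>|s i x| \<le> 2 * |f x|\<close>, whence the
    factor 3.\<close>
  proof (rule integral_dominated_convergence[where w="\<lambda>x. 3 * \<bar>f x\<bar>"])
    show "AE x in lborel. (\<lambda>i. \<bar>f x - s i x\<bar>) \<longlonglongrightarrow> 0"
    proof (rule AE_I2)
      fix x
      have "(\<lambda>i. \<bar>f x - s i x\<bar>) \<longlonglongrightarrow> \<bar>f x - f x\<bar>"
        by (intro tendsto_intros lim) simp
      then show "(\<lambda>i. \<bar>f x - s i x\<bar>) \<longlonglongrightarrow> 0" by simp
    qed
    show "AE x in lborel. norm \<bar>f x - s i x\<bar> \<le> 3 * \<bar>f x\<bar>" for i
    proof (rule AE_I2)
      fix x show "norm \<bar>f x - s i x\<bar> \<le> 3 * \<bar>f x\<bar>"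
        using lim.hyps(3)[of x i] by simp
    qed
  qed (use lim in auto)
  show ?case
  proof (rule L1_shift_approx)
    fix \<epsilon> :: real assume "\<epsilon> > 0"
    then obtain i where "(\<integral>x. \<bar>f x - s i x\<bar> \<partial>lborel) < \<epsilon>"
      using order_tendstoD(2)[OF conv, of \<epsilon>] by (auto simp: eventually_sequentially)
    then show "\<exists>g. integrable lborel g \<and> (\<integral>x. \<bar>f x - g x\<bar> \<partial>lborel) < \<epsilon> \<and>
       (\<lambda>n. \<integral>x. \<bar>g (x + h n) - g x\<bar> \<partial>lborel) \<longlonglongrightarrow> 0"
      using lim by blast
  qed (use lim in auto)
qed

lemma L1_shift_continuous:
  fixes v :: "'a::euclidean_space \<Rightarrow> real"
  assumes v: "integrable lborel v" and "\<epsilon> > 0"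
  obtains \<delta> where "\<delta> > 0" "\<And>h. norm h < \<delta> \<Longrightarrow> (\<integral>x. \<bar>v (x + h) - v x\<bar> \<partial>lborel) < \<epsilon>"
proof -
  have "((\<lambda>h. \<integral>x. \<bar>v (x + h) - v x\<bar> \<partial>lborel) \<longlongrightarrow> 0) (at 0)"
    unfolding tendsto_at_iff_sequentially using L1_shift_tendsto_sequentially[OF v] by (auto simp: o_def)
  from LIM_D[OF this \<open>\<epsilon> > 0\<close>] obtain \<delta> where \<delta>: "\<delta> > 0"
    "\<And>h. h \<noteq> 0 \<Longrightarrow> norm h < \<delta> \<Longrightarrow> \<bar>\<integral>x. \<bar>v (x + h) - v x\<bar> \<partial>lborel\<bar> < \<epsilon>"
    by auto
  have "(\<integral>x. \<bar>v (x + h) - v x\<bar> \<partial>lborel) < \<epsilon>" if "norm h < \<delta>" for h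
    using \<delta>(2)[of h] that \<open>\<epsilon> > 0\<close> by (cases "h = 0") auto
  with \<delta>(1) show ?thesis by (rule that)
qed

section \<open>Oscillation along the edges of a square\<close>

text \<open>The segment has length \<open>r |e|\<close> and starts at \<open>x + r w\<close>, while
  the comparison value stays at \<open>x\<close>. With \<open>w\<close> zero or a unit vector and
  \<open>e\<close> a unit vector this describes all four edges of the square with corner
  \<open>x\<close>. There is no division by \<open>r\<close> yet, as the edge estimates use the
  plain integral.\<close>

definition osc :: "('a::euclidean_space \<Rightarrow> real) \<Rightarrow> 'a \<Rightarrow> 'a \<Rightarrow> real \<Rightarrow> 'a \<Rightarrow> real" where
  "osc v w e r x = (\<integral>s. indicator {0..r} s * \<bar>v (x + r *\<^sub>R w + s *\<^sub>R e) - v x\<bar> \<partial>lborel)"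

lemma osc_L1:
  fixes v :: "'a::euclidean_space \<Rightarrow> real"
  assumes v: "integrable lborel v" and "r \<ge> 0"
  shows "integrable lborel (osc v w e r)"
    and "(\<integral>x. osc v w e r x \<partial>lborel) =
      (\<integral>s. indicator {0..r} s * (\<integral>x. \<bar>v (x + r *\<^sub>R w + s *\<^sub>R e) - v x\<bar> \<partial>lborel) \<partial>lborel)"
proof -
  let ?F = "\<lambda>s x. indicator {0..r} s * \<bar>v (x + r *\<^sub>R w + s *\<^sub>R e) - v x\<bar>"
  have [measurable]: "v \<in> borel_measurable borel" using v by auto
  have 1: "integrable (lborel \<Otimes>\<^sub>M lborel) (\<lambda>(s, x). indicator {0..r} s * v (x + s *\<^sub>R e + r *\<^sub>R w))"
    by (rule integrable_line_pair1[OF integrable_lborel_shift[OF v, of "r *\<^sub>R w"]])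
  have 2: "integrable (lborel \<Otimes>\<^sub>M lborel) (\<lambda>(s, x). indicator {0..r} s * v x)"
    using integrable_line_pair1[OF v, of r 0] by simp
  have "integrable (lborel \<Otimes>\<^sub>M lborel) (case_prod ?F)"
    by (rule Bochner_Integration.integrable_bound[OF integrable_abs[OF Bochner_Integration.integrable_diff[OF 1 2]]])
       (auto simp: algebra_simps split: split_indicator)
  note F = this
  show "integrable lborel (osc v w e r)"
    using lborel_pair.integrable_snd[OF F] by (simp add: osc_def[abs_def])
  show "(\<integral>x. osc v w e r x \<partial>lborel) =
      (\<integral>s. indicator {0..r} s * (\<integral>x. \<bar>v (x + r *\<^sub>R w + s *\<^sub>R e) - v x\<bar> \<partial>lborel) \<partial>lborel)"
    using lborel_pair.Fubini_integral[OF F] by (simp add: osc_def[abs_def])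
qed

lemma osc_nonneg: "0 \<le> osc v w e r x"
  unfolding osc_def by (rule Bochner_Integration.integral_nonneg) simp

text \<open>After Fubini the quotient is an average over \<open>s\<close> of \<open>L^1\<close>
  distances between \<open>v\<close> and its translates by vectors of norm at most
  \<open>r (|w| + |e|)\<close>, so continuity of translations bounds all of them at once.\<close>

lemma osc_average_tendsto_0:
  fixes v :: "'a::euclidean_space \<Rightarrow> real"
  assumes v: "integrable lborel v" and r: "r \<longlonglongrightarrow> 0" "\<And>n. r n > 0"
  shows "(\<lambda>n. (\<integral>x. osc v w e (r n) x \<partial>lborel) / r n) \<longlonglongrightarrow> 0"
proof (rule LIMSEQ_I)
  fix \<epsilon> :: real assume e: "\<epsilon> > 0"
  then obtain \<delta> where \<delta>: "\<delta> > 0" "\<And>h. norm h < \<delta> \<Longrightarrow> (\<integral>x. \<bar>v (x + h) - v x\<bar> \<partial>lborel) < \<epsilon>/2"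
    using L1_shift_continuous[OF v, of "\<epsilon>/2"] by auto
  let ?m = "norm w + norm e + 1"
  have m: "?m > 0" by (simp add: add_nonneg_pos)
  have "eventually (\<lambda>n. r n < \<delta> / ?m) sequentially"
    using order_tendstoD(2)[OF r(1)] \<delta>(1) m by simp
  then obtain N where N: "\<And>n. n \<ge> N \<Longrightarrow> r n < \<delta> / ?m" by (auto simp: eventually_sequentially)
  have "(\<integral>x. osc v w e (r n) x \<partial>lborel) / r n < \<epsilon>" if n: "n \<ge> N" for n
  proof -
    have rn: "r n > 0" by (rule r)
    have rm: "r n * ?m < \<delta>" using N[OF n] m by (simp add: pos_less_divide_eq)
    have small: "(\<integral>x. \<bar>v (x + r n *\<^sub>R w + s *\<^sub>R e) - v x\<bar> \<partial>lborel) \<le> \<epsilon>/2" if "s \<in> {0..r n}" for s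
    proof -
      have "norm (r n *\<^sub>R w + s *\<^sub>R e) \<le> r n * norm w + s * norm e"
        using rn that by (intro order_trans[OF norm_triangle_ineq]) auto
      also have "\<dots> \<le> r n * norm w + r n * norm e"
        using that by (auto intro!: mult_right_mono)
      also have "\<dots> \<le> r n * ?m" using rn by (simp add: algebra_simps)
      also note rm
      finally show ?thesis using \<delta>(2)[of "r n *\<^sub>R w + s *\<^sub>R e"] by (simp add: add.assoc)
    qed
    have "(\<integral>x. osc v w e (r n) x \<partial>lborel) \<le> (\<integral>s. indicator {0..r n} s * (\<epsilon>/2) \<partial>lborel)"
    proof (subst osc_L1(2)[OF v], use rn in simp)
      show "(\<integral>s. indicator {0..r n} s * (\<integral>x. \<bar>v (x + r n *\<^sub>R w + s *\<^sub>R e) - v x\<bar> \<partial>lborel) \<partial>lborel)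
        \<le> (\<integral>s. indicator {0..r n} s * (\<epsilon>/2) \<partial>lborel)"
        by (rule integral_mono') (use rn e small in \<open>auto split: split_indicator\<close>)
    qed
    also have "\<dots> = r n * (\<epsilon>/2)" using rn by simp
    also have "\<dots> < r n * \<epsilon>" using rn e by simp
    finally show ?thesis using rn by (simp add: pos_divide_less_eq mult.commute)
  qed
  moreover have "0 \<le> (\<integral>x. osc v w e (r n) x \<partial>lborel) / r n" for n
    using r(2)[of n] by (intro divide_nonneg_pos Bochner_Integration.integral_nonneg osc_nonneg)
  ultimately show "\<exists>N. \<forall>n\<ge>N. norm ((\<integral>x. osc v w e (r n) x \<partial>lborel) / r n - 0) < \<epsilon>"
    by (intro exI[of _ N]) (auto simp del: abs_divide)
qed

section \<open>Weak derivatives along coordinate lines\<close>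

text \<open>A product of two flat exponentials, one for each endpoint. Instead of rescaling,
  \<open>k\<close> tends to 0: the support stays fixed, the bound 1 persists, and the limit is the
  indicator of the open interval.\<close>

definition bump :: "real \<Rightarrow> real \<Rightarrow> real \<Rightarrow> real \<Rightarrow> real" where
  "bump k lo hi t = flat_exp 0 k (t - lo) * flat_exp 0 k (hi - t)"

lemma bump_smooth1:
  assumes "k > 0"
  shows "bump k lo hi \<in> smooth1"
proof -
  have "(\<lambda>t. flat_exp 0 k (1 * t + - lo) * flat_exp 0 k ((-1) * t + hi)) \<in> smooth1"
    by (intro smooth1.mult smooth1.flat assms)
  then show ?thesis by (simp add: bump_def[abs_def])
qed

lemma bump_nonneg: "0 \<le> bump k lo hi t"
  and bump_le_1: "k > 0 \<Longrightarrow> bump k lo hi t \<le> 1"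
  and bump_outside: "\<not> (lo < t \<and> t < hi) \<Longrightarrow> bump k lo hi t = 0"
  by (auto simp: bump_def flat_exp_def intro!: mult_le_one)

lemma bump_tendsto_indicator:
  assumes "k \<longlonglongrightarrow> 0"
  shows "(\<lambda>n. bump (k n) lo hi t) \<longlonglongrightarrow> indicator {lo<..<hi} t"
proof (cases "lo < t \<and> t < hi")
  case True
  have "(\<lambda>n. exp (- (k n / (t - lo))) * exp (- (k n / (hi - t)))) \<longlonglongrightarrow> exp (- (0 / (t - lo))) * exp (- (0 / (hi - t)))"
    using True by (intro tendsto_intros assms) auto
  then show ?thesis using True by (simp add: bump_def flat_exp_def)
qed (auto simp: bump_outside)

definition box_bump :: "real \<Rightarrow> real^'m \<Rightarrow> real^'m \<Rightarrow> real^'m \<Rightarrow> real" where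
  "box_bump k lo hi x = (\<Prod>l\<in>UNIV. bump k (lo $ l) (hi $ l) (x $ l))"

lemma smooth1_continuous: "f \<in> smooth1 \<Longrightarrow> continuous_on UNIV f"
  using smooth1_derivative DERIV_isCont by (metis continuous_at_imp_continuous_on)

lemma coord_smooth_has_frechet:
  "f \<in> coord_smooth \<Longrightarrow> (f has_derivative frechet_derivative f (at x)) (at x)"
  using coord_smooth_derivative frechet_derivative_works differentiable_def by blast

lemma coord_smooth_continuous: "f \<in> coord_smooth \<Longrightarrow> continuous_on UNIV f"
  using coord_smooth_has_frechet has_derivative_continuous continuous_at_imp_continuous_on by metis

lemma partial_eq_line_derivative:
  fixes f :: "real^'m \<Rightarrow> real"
  assumes "f \<in> coord_smooth" "((\<lambda>\<tau>. f (x + \<tau> *\<^sub>R axis i 1)) has_real_derivative y) (at 0)"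
  shows "partial i f x = y"
proof -
  have lin: "((\<lambda>\<tau>. x + \<tau> *\<^sub>R (axis i 1 :: real^'m)) has_derivative (\<lambda>\<tau>. \<tau> *\<^sub>R axis i 1)) (at 0)"
    by (auto intro!: derivative_eq_intros)
  have "((\<lambda>\<tau>. f (x + \<tau> *\<^sub>R axis i 1)) has_derivative
      (\<lambda>\<tau>. frechet_derivative f (at x) (\<tau> *\<^sub>R axis i 1))) (at 0)"
    by (rule has_derivative_compose[OF lin]) (use coord_smooth_has_frechet[OF assms(1)] in simp)
  from has_derivative_unique[OF this assms(2)[unfolded has_field_derivative_def]]
  have "frechet_derivative f (at x) (1 *\<^sub>R axis i 1) = y * 1" by metis
  then show ?thesis by (simp add: partial_def)
qed

lemma box_bump_coord_smooth:
  assumes "k > 0"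
  shows "box_bump k lo hi \<in> coord_smooth"
  unfolding box_bump_def[abs_def] by (intro coord_smooth_prod bump_smooth1 assms) simp

lemma box_bump_measurable [measurable]: "k > 0 \<Longrightarrow> box_bump k lo hi \<in> borel_measurable borel"
  by (intro borel_measurable_continuous_onI coord_smooth_continuous box_bump_coord_smooth)

lemma box_bump_bounds:
  assumes "k > 0"
  shows "0 \<le> box_bump k lo hi x" "box_bump k lo hi x \<le> 1" "\<bar>box_bump k lo hi x\<bar> \<le> 1"
proof -
  show "0 \<le> box_bump k lo hi x"
    unfolding box_bump_def by (intro prod_nonneg) (simp add: bump_nonneg)
  moreover show "box_bump k lo hi x \<le> 1"
    unfolding box_bump_def by (intro prod_le_1) (simp add: bump_nonneg bump_le_1 assms)
  ultimately show "\<bar>box_bump k lo hi x\<bar> \<le> 1" by simp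
qed

lemma box_bump_outside: "x \<notin> box lo hi \<Longrightarrow> box_bump k lo hi x = 0"
proof -
  assume "x \<notin> box lo hi"
  then obtain l where "\<not> (lo $ l < x $ l \<and> x $ l < hi $ l)" by (auto simp: mem_box_cart)
  then show ?thesis
    unfolding box_bump_def by (intro prod_zero bexI[of _ l]) (auto simp: bump_outside)
qed

lemma box_bump_tendsto_indicator:
  assumes "k \<longlonglongrightarrow> 0"
  shows "(\<lambda>n. box_bump (k n) lo hi x) \<longlonglongrightarrow> indicator (box lo hi) x"
proof -
  have "(\<lambda>n. box_bump (k n) lo hi x) \<longlonglongrightarrow> (\<Prod>l\<in>UNIV. indicator {lo $ l<..<hi $ l} (x $ l))"
    unfolding box_bump_def by (intro tendsto_prod bump_tendsto_indicator assms)
  also have "(\<Prod>l\<in>UNIV. indicator {lo $ l<..<hi $ l} (x $ l)) = (indicator (box lo hi) x :: real)"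
  proof (cases "x \<in> box lo hi")
    case False
    then obtain l where "\<not> (lo $ l < x $ l \<and> x $ l < hi $ l)" by (auto simp: mem_box_cart)
    then have "(\<Prod>l\<in>UNIV. indicator {lo $ l<..<hi $ l} (x $ l)) = (0::real)"
      by (intro prod_zero bexI[of _ l]) auto
    then show ?thesis using False by simp
  qed (auto simp: mem_box_cart)
  finally show ?thesis .
qed

text \<open>A global Borel form of the weak derivative: both functions are integrable on the whole
  space, so translations and Fubini apply without tracking domains, while the relation between them
  is imposed only through tests inside the box.\<close>

definition weak_on :: "real^'m \<Rightarrow> real^'m \<Rightarrow> 'm \<Rightarrow> (real^'m \<Rightarrow> real) \<Rightarrow> (real^'m \<Rightarrow> real) \<Rightarrow> bool" where
  "weak_on a b i u v \<longleftrightarrow> integrable lborel u \<and> integrable lborel v \<and>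
     (\<forall>\<phi>. test_fun (box a b) \<phi> \<longrightarrow>
        (\<integral>x. u x * partial i \<phi> x \<partial>lborel) = - (\<integral>x. v x * \<phi> x \<partial>lborel))"

lemma integrable_mult_box_bump:
  assumes "integrable lborel g" "k > 0"
  shows "integrable lborel (\<lambda>x. g x * box_bump k lo hi (x + h))"
proof (rule Bochner_Integration.integrable_bound[OF assms(1)])
  have [measurable]: "g \<in> borel_measurable borel" using assms by auto
  show "(\<lambda>x. g x * box_bump k lo hi (x + h)) \<in> borel_measurable lborel"
    using assms(2) by simp
  show "AE x in lborel. norm (g x * box_bump k lo hi (x + h)) \<le> norm (g x)"
    using box_bump_bounds(3)[OF assms(2), of lo hi]
    by (intro AE_I2) (simp add: abs_mult mult_right_le_one_le)
qed

text \<open>The test function is \<open>\<psi>(x) = \<integral>\<^sub>0\<^sup>t \<phi>(x - s e\<^sub>i) ds\<close>, whose \<open>i\<close>-th partial derivative is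
  \<open>\<phi>(x) - \<phi>(x - t e\<^sub>i)\<close>.\<close>
lemma weak_on_box_bump:
  fixes u v :: "real^'m \<Rightarrow> real"
  assumes w: "weak_on a b i u v" and t: "0 \<le> t" and k: "k > 0"
    and sub: "cbox lo (hi + t *\<^sub>R axis i 1) \<subseteq> box a b"
  shows "(\<integral>x. (u (x + t *\<^sub>R axis i 1) - u x) * box_bump k lo hi x \<partial>lborel) =
     (\<integral>x. (\<integral>s. indicator {0..t} s * v (x + s *\<^sub>R axis i 1) \<partial>lborel) * box_bump k lo hi x \<partial>lborel)"
proof -
  let ?e = "axis i 1 :: real^'m"
  let ?\<phi> = "box_bump k lo hi"
  let ?\<eta> = "bump k (lo $ i) (hi $ i)"
  have u: "integrable lborel u" and v: "integrable lborel v" using w by (auto simp: weak_on_def)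
  have [measurable]: "u \<in> borel_measurable borel" "v \<in> borel_measurable borel" using u v by auto
  have [measurable]: "?\<phi> \<in> borel_measurable borel" using k by simp
  have cont: "isCont ?\<eta> y" for y
    using smooth1_continuous[OF bump_smooth1[OF k]] continuous_on_eq_continuous_at by blast
  obtain H where H: "\<And>y. (H has_real_derivative ?\<eta> y) (at y)"
    using einterval_antiderivative[of "-\<infinity>" "\<infinity>" ?\<eta>] cont
    by (auto simp: has_real_derivative_iff_has_vector_derivative)
  have Hsm: "H \<in> smooth1" by (rule smooth1.primitive[OF bump_smooth1[OF k] H])
  have sm: "(\<lambda>y. H y + (-1) * H (y - t)) \<in> smooth1"
    by (intro smooth1.add smooth1.mult smooth1.const smooth1.shift Hsm)
  define R where "R x = (\<Prod>l\<in>UNIV - {i}. bump k (lo $ l) (hi $ l) (x $ l))" for x :: "real^'m"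
  \<comment> \<open>The averaged bump in closed form: \<open>R\<close> is constant in direction
    \<open>i\<close> and comes out of the average. Smoothness and the partial derivative are read
    off here; the support and the Fubini argument use the integral form
    \<open>\<psi>int\<close>.\<close>
  define \<psi> where "\<psi> x = R x * (H (x $ i) - H (x $ i - t))" for x :: "real^'m"
  have R: "R (x + \<tau> *\<^sub>R ?e) = R x" for x \<tau>
    unfolding R_def by (intro prod.cong) (auto simp: axis_def)
  have \<phi>R: "?\<phi> x = R x * ?\<eta> (x $ i)" for x
    unfolding box_bump_def R_def by (subst prod.remove[of _ i]) (auto simp: mult.commute)
  have "(\<lambda>x. R x * (H (x $ i) + (-1) * H (x $ i - t))) \<in> coord_smooth"
    unfolding R_def
    by (intro coord_smooth.mult coord_smooth_prod coord_smooth.coord[OF sm] bump_smooth1 k) simp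
  then have \<psi>sm: "\<psi> \<in> coord_smooth" by (simp add: \<psi>_def[abs_def])
  have part: "partial i \<psi> x = ?\<phi> x - ?\<phi> (x + (- t) *\<^sub>R ?e)" for x
  proof (rule partial_eq_line_derivative[OF \<psi>sm])
    have "((\<lambda>\<tau>. R x * (H (x $ i + \<tau>) - H (x $ i - t + \<tau>))) has_real_derivative
       R x * (?\<eta> (x $ i + 0) - ?\<eta> (x $ i - t + 0))) (at 0)"
      by (intro DERIV_cmult DERIV_diff DERIV_cong[OF DERIV_chain2[OF H]])
         (auto intro!: derivative_eq_intros)
    moreover have "\<psi> (x + \<tau> *\<^sub>R ?e) = R x * (H (x $ i + \<tau>) - H (x $ i - t + \<tau>))" for \<tau>
      unfolding \<psi>_def R by (simp add: algebra_simps)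
    moreover have "R x * (?\<eta> (x $ i + 0) - ?\<eta> (x $ i - t + 0)) = ?\<phi> x - ?\<phi> (x + (- t) *\<^sub>R ?e)"
      unfolding \<phi>R R by (simp add: algebra_simps)
    ultimately show "((\<lambda>\<tau>. \<psi> (x + \<tau> *\<^sub>R ?e)) has_real_derivative ?\<phi> x - ?\<phi> (x + (- t) *\<^sub>R ?e)) (at 0)"
      by simp
  qed
  have \<psi>int: "\<psi> x = (\<integral>s. indicator {0..t} s * ?\<phi> (x + (- s) *\<^sub>R ?e) \<partial>lborel)" for x
  proof -
    have "(\<integral>s. ?\<eta> (x $ i - s) * indicator {0..t} s \<partial>lborel) = - H (x $ i - t) - (- H (x $ i - 0))"
    proof (rule integral_FTC_Icc_real)
      show "((\<lambda>s. - H (x $ i - s)) has_real_derivative ?\<eta> (x $ i - s)) (at s)" for s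
        by (rule DERIV_cong[OF DERIV_minus[OF DERIV_chain2[OF H]]]) (auto intro!: derivative_eq_intros)
      show "isCont (\<lambda>s. ?\<eta> (x $ i - s)) s" for s
        by (rule isCont_o2[OF _ cont]) (intro continuous_intros)
    qed (rule t)
    then have "\<psi> x = R x * (\<integral>s. indicator {0..t} s * ?\<eta> (x $ i - s) \<partial>lborel)"
      by (simp add: \<psi>_def mult.commute)
    also have "\<dots> = (\<integral>s. R x * (indicator {0..t} s * ?\<eta> (x $ i - s)) \<partial>lborel)"
      by simp
    also have "\<dots> = (\<integral>s. indicator {0..t} s * ?\<phi> (x + (- s) *\<^sub>R ?e) \<partial>lborel)"
      unfolding \<phi>R R by (intro Bochner_Integration.integral_cong) (simp_all add: mult_ac)
    finally show ?thesis .
  qed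
  \<comment> \<open>A nonzero average forces some translate of the bump by \<open>s\<close> in
    \<open>{0..t}\<close> to be nonzero at \<open>x\<close>, so the support lies in the box
    stretched by \<open>t\<close> in direction \<open>i\<close>.\<close>
  have supp: "x \<in> cbox lo (hi + t *\<^sub>R ?e)" if "\<psi> x \<noteq> 0" for x
  proof -
    have "\<exists>s\<in>{0..t}. ?\<phi> (x + (- s) *\<^sub>R ?e) \<noteq> 0"
    proof (rule ccontr)
      assume "\<not> ?thesis"
      then have "(\<lambda>s. indicator {0..t} s * ?\<phi> (x + (- s) *\<^sub>R ?e)) = (\<lambda>s. 0)"
        by (auto split: split_indicator)
      then show False using that \<psi>int[of x] by simp
    qed
    then obtain s where s: "0 \<le> s" "s \<le> t" "x + (- s) *\<^sub>R ?e \<in> box lo hi"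
      using box_bump_outside by force
    then have "lo $ l < x $ l - s * ?e $ l \<and> x $ l - s * ?e $ l < hi $ l" for l
      by (simp add: mem_box_cart)
    moreover have "0 \<le> s * ?e $ l" "s * ?e $ l \<le> t * ?e $ l" for l
      using s by (auto simp: axis_def)
    ultimately have "lo $ l \<le> x $ l \<and> x $ l \<le> hi $ l + t * ?e $ l" for l
      by (smt (verit))
    then show ?thesis by (simp add: mem_box_cart)
  qed
  have clos: "closure {x. \<psi> x \<noteq> 0} \<subseteq> cbox lo (hi + t *\<^sub>R ?e)"
    by (rule closure_minimal) (use supp in auto)
  then have "compact (closure {x. \<psi> x \<noteq> 0})"
    using compact_cbox closed_closure compact_closure bounded_subset bounded_cbox closure_subset by metis
  then have "test_fun (box a b) \<psi>"
    unfolding test_fun_def using clos sub coord_smooth_smooth_fun[OF \<psi>sm] by auto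
  then have W: "(\<integral>x. u x * partial i \<psi> x \<partial>lborel) = - (\<integral>x. v x * \<psi> x \<partial>lborel)"
    using w by (auto simp: weak_on_def)
  have int\<phi>: "integrable lborel (\<lambda>x. g x * ?\<phi> x)" if "integrable lborel g" for g
    using integrable_mult_box_bump[OF that k, of lo hi 0] by simp
  have left: "(\<integral>x. u x * partial i \<psi> x \<partial>lborel) =
    - (\<integral>x. (u (x + t *\<^sub>R ?e) - u x) * ?\<phi> x \<partial>lborel)"
  proof -
    have "(\<integral>x. u x * partial i \<psi> x \<partial>lborel) =
       (\<integral>x. u x * ?\<phi> x - u x * ?\<phi> (x + (- t) *\<^sub>R ?e) \<partial>lborel)"
      by (simp only: part right_diff_distrib)
    also have "\<dots> = (\<integral>x. u x * ?\<phi> x \<partial>lborel) - (\<integral>x. u x * ?\<phi> (x + (- t) *\<^sub>R ?e) \<partial>lborel)"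
      by (intro Bochner_Integration.integral_diff int\<phi> integrable_mult_box_bump u k)
    also have "(\<integral>x. u x * ?\<phi> (x + (- t) *\<^sub>R ?e) \<partial>lborel) = (\<integral>x. u (x + t *\<^sub>R ?e) * ?\<phi> x \<partial>lborel)"
      using integral_lborel_shift[of "\<lambda>x. u x * ?\<phi> (x + (- t) *\<^sub>R ?e)" "t *\<^sub>R ?e"] by simp
    also have "(\<integral>x. u x * ?\<phi> x \<partial>lborel) - (\<integral>x. u (x + t *\<^sub>R ?e) * ?\<phi> x \<partial>lborel) =
      - (\<integral>x. u (x + t *\<^sub>R ?e) * ?\<phi> x - u x * ?\<phi> x \<partial>lborel)"
      by (subst Bochner_Integration.integral_diff) (auto intro!: int\<phi> integrable_lborel_shift u)
    finally show ?thesis by (simp only: left_diff_distrib)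
  qed
  have F: "integrable (lborel \<Otimes>\<^sub>M lborel) (\<lambda>(s, x). indicator {0..t} s * (v x * ?\<phi> (x + (- s) *\<^sub>R ?e)))"
  proof (rule Bochner_Integration.integrable_bound[OF integrable_line_pair1[OF v, of t 0]])
    show "AE y in lborel \<Otimes>\<^sub>M lborel. norm (case y of (s, x) \<Rightarrow> indicator {0..t} s * (v x * ?\<phi> (x + (- s) *\<^sub>R ?e)))
      \<le> norm (case y of (s, x) \<Rightarrow> indicator {0..t} s * v (x + s *\<^sub>R 0))"
      using box_bump_bounds(3)[OF k, of lo hi]
      by (intro AE_I2) (auto simp: abs_mult intro!: mult_right_le_one_le split: split_indicator)
  qed measurable
  have "(\<integral>x. v x * \<psi> x \<partial>lborel) = (\<integral>x. (\<integral>s. indicator {0..t} s * (v x * ?\<phi> (x + (- s) *\<^sub>R ?e)) \<partial>lborel) \<partial>lborel)"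
    by (simp add: \<psi>int mult.left_commute flip: integral_mult_right_zero)
  also have "\<dots> = (\<integral>s. (\<integral>x. indicator {0..t} s * (v x * ?\<phi> (x + (- s) *\<^sub>R ?e)) \<partial>lborel) \<partial>lborel)"
    by (rule lborel_pair.Fubini_integral[OF F])
  \<comment> \<open>For each \<open>s\<close> a change of variables moves the translation from the
    bump to \<open>v\<close>.\<close>
  also have "\<dots> = (\<integral>s. (\<integral>x. indicator {0..t} s * (v (x + s *\<^sub>R ?e) * ?\<phi> x) \<partial>lborel) \<partial>lborel)"
  proof (rule Bochner_Integration.integral_cong[OF refl])
    fix s
    show "(\<integral>x. indicator {0..t} s * (v x * ?\<phi> (x + (- s) *\<^sub>R ?e)) \<partial>lborel) =
       (\<integral>x. indicator {0..t} s * (v (x + s *\<^sub>R ?e) * ?\<phi> x) \<partial>lborel)"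
      using integral_lborel_shift[of "\<lambda>x. indicator {0..t} s * (v x * ?\<phi> (x + (- s) *\<^sub>R ?e))" "s *\<^sub>R ?e"]
      by auto
  qed
  also have "\<dots> = (\<integral>x. (\<integral>s. indicator {0..t} s * (v (x + s *\<^sub>R ?e) * ?\<phi> x) \<partial>lborel) \<partial>lborel)"
    by (rule lborel_pair.Fubini_integral[symmetric, OF integrable_line_pair[OF v _ box_bump_bounds(3)[OF k]]]) simp
  also have "\<dots> = (\<integral>x. (\<integral>s. indicator {0..t} s * v (x + s *\<^sub>R ?e) \<partial>lborel) * ?\<phi> x \<partial>lborel)"
    by (simp flip: mult.assoc integral_mult_left_zero)
  finally show ?thesis using W left by simp
qed

lemma box_Int_box_cart:
  fixes a b c d :: "real^'m"
  shows "box a b \<inter> box c d = box (\<chi> l. max (a $ l) (c $ l)) (\<chi> l. min (b $ l) (d $ l))"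
  by (auto simp: mem_box_cart)

text \<open>Letting the bumps tend to indicators shows that the defect in the fundamental theorem of
  calculus has integral zero over every subbox, hence vanishes almost everywhere. The null set
  depends on \<open>t\<close>.\<close>

lemma weak_on_line:
  fixes u v :: "real^'m \<Rightarrow> real"
  assumes w: "weak_on a b i u v" and t: "0 \<le> t"
    and sub: "cbox c (d + t *\<^sub>R axis i 1) \<subseteq> box a b"
  shows "AE x in lborel. x \<in> box c d \<longrightarrow>
     u (x + t *\<^sub>R axis i 1) - u x = (\<integral>s. indicator {0..t} s * v (x + s *\<^sub>R axis i 1) \<partial>lborel)"
proof -
  let ?e = "axis i 1 :: real^'m"
  have u: "integrable lborel u" and v: "integrable lborel v" using w by (auto simp: weak_on_def)
  define V where "V x = (\<integral>s. indicator {0..t} s * v (x + s *\<^sub>R ?e) \<partial>lborel)" for x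
  have V: "integrable lborel V"
    using lborel_pair.integrable_snd[OF integrable_line_pair1[OF v, of t ?e]] by (simp add: V_def[abs_def])
  define g where "g x = u (x + t *\<^sub>R ?e) - u x - V x" for x
  have g: "integrable lborel g"
    unfolding g_def by (intro Bochner_Integration.integrable_diff integrable_lborel_shift u V)
  have [measurable]: "g \<in> borel_measurable borel" using g by auto
  have box0: "(\<integral>x. indicator (box lo hi) x * g x \<partial>lborel) = 0"
    if "box lo hi \<subseteq> box c d" for lo hi
  proof (cases "box lo hi = {}")
    case False
    have "\<And>l. c $ l \<le> lo $ l \<and> hi $ l \<le> d $ l"
      using that False by (auto simp: subset_interval_cart interval_ne_empty_cart not_less)
    then have "cbox lo (hi + t *\<^sub>R ?e) \<subseteq> cbox c (d + t *\<^sub>R ?e)"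
      unfolding subset_iff mem_box_cart by (smt (verit) vector_add_component)
    then have sub': "cbox lo (hi + t *\<^sub>R ?e) \<subseteq> box a b" using sub by auto
    define k where "k n = inverse (real (Suc n))" for n
    have k: "k n > 0" for n by (simp add: k_def)
    have k0: "k \<longlonglongrightarrow> 0" unfolding k_def[abs_def] by (rule LIMSEQ_inverse_real_of_nat)
    have zero: "(\<integral>x. box_bump (k n) lo hi x * g x \<partial>lborel) = 0" for n
    proof -
      have ib: "integrable lborel (\<lambda>x. h x * box_bump (k n) lo hi x)" if "integrable lborel h" for h
        using integrable_mult_box_bump[OF that k, of n lo hi 0] by simp
      have "(\<integral>x. box_bump (k n) lo hi x * g x \<partial>lborel) =
        (\<integral>x. (u (x + t *\<^sub>R ?e) - u x) * box_bump (k n) lo hi x - V x * box_bump (k n) lo hi x \<partial>lborel)"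
        by (simp add: g_def algebra_simps)
      also have "\<dots> = (\<integral>x. (u (x + t *\<^sub>R ?e) - u x) * box_bump (k n) lo hi x \<partial>lborel)
         - (\<integral>x. V x * box_bump (k n) lo hi x \<partial>lborel)"
        by (intro Bochner_Integration.integral_diff ib Bochner_Integration.integrable_diff
            integrable_lborel_shift u V)
      also have "\<dots> = 0"
        using weak_on_box_bump[OF w t k[of n] sub'] by (simp add: V_def)
      finally show ?thesis .
    qed
    have "(\<lambda>n. \<integral>x. box_bump (k n) lo hi x * g x \<partial>lborel) \<longlonglongrightarrow> (\<integral>x. indicator (box lo hi) x * g x \<partial>lborel)"
    proof (rule integral_dominated_convergence[where w="\<lambda>x. \<bar>g x\<bar>"])
      show "AE x in lborel. (\<lambda>n. box_bump (k n) lo hi x * g x) \<longlonglongrightarrow> indicator (box lo hi) x * g x"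
        by (intro AE_I2 tendsto_mult_right box_bump_tendsto_indicator k0)
      show "AE x in lborel. norm (box_bump (k n) lo hi x * g x) \<le> \<bar>g x\<bar>" for n
        using box_bump_bounds(3)[OF k[of n], of lo hi] by (intro AE_I2) (simp add: abs_mult mult_left_le_one_le)
    qed (use g k in auto)
    then show ?thesis using zero by (simp add: LIMSEQ_const_iff)
  qed simp
  \<comment> \<open>Cutting the defect off to \<open>box c d\<close> makes arbitrary boxes
    admissible, because the intersection of two boxes is a box.\<close>
  have "AE x in lborel. indicator (box c d) x * g x = 0"
  proof (rule AE_zero_if_box_integrals_zero)
    show "integrable lborel (\<lambda>x. indicator (box c d) x * g x)"
      using integrable_real_mult_indicator[OF _ g, of "box c d"] by (simp add: mult.commute)
    show "(\<integral>x. indicator (box lo hi) x * (indicator (box c d) x * g x) \<partial>lborel) = 0" for lo hi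
    proof -
      have "(\<integral>x. indicator (box lo hi) x * (indicator (box c d) x * g x) \<partial>lborel) =
        (\<integral>x. indicator (box lo hi \<inter> box c d) x * g x \<partial>lborel)"
        by (simp add: indicator_inter_arith mult.assoc)
      also have "\<dots> = 0"
        unfolding box_Int_box_cart by (rule box0) (auto simp: mem_box_cart)
      finally show ?thesis .
    qed
    show "(\<integral>x. indicator (box c d) x * g x \<partial>lborel) = 0" by (rule box0) simp
  qed
  then show ?thesis by eventually_elim (auto simp: g_def V_def)
qed

section \<open>Contour integrals over squares\<close>

text \<open>Absolute continuity along a segment, for functions fixed only up to null sets: the
  integral formula holds for almost every \<open>t\<close>. The endpoint \<open>t = r\<close> is
  required separately, since it carries the corner value that adjacent edges must share.\<close>

definition good_edge ::
  "nat \<Rightarrow> (nat \<Rightarrow> real^'m \<Rightarrow> real) \<Rightarrow> (nat \<Rightarrow> 'm \<Rightarrow> real^'m \<Rightarrow> real) \<Rightarrow> 'm \<Rightarrow> real \<Rightarrow> real^'m \<Rightarrow> bool" where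
  "good_edge n u v i r q \<longleftrightarrow>
     (\<forall>k\<in>{1..2*n+1}. integrable lborel (\<lambda>s. indicator {0..r} s * v k i (q + s *\<^sub>R axis i 1)) \<and>
        u k (q + r *\<^sub>R axis i 1) - u k q = (\<integral>s. indicator {0..r} s * v k i (q + s *\<^sub>R axis i 1) \<partial>lborel) \<and>
        (AE t in lborel. t \<in> {0..r} \<longrightarrow>
           u k (q + t *\<^sub>R axis i 1) - u k q = (\<integral>s. indicator {0..t} s * v k i (q + s *\<^sub>R axis i 1) \<partial>lborel))) \<and>
     (AE t in lborel. t \<in> {0..r} \<longrightarrow> v (2*n+1) i (q + t *\<^sub>R axis i 1) =
        (\<Sum>j=1..n. u j (q + t *\<^sub>R axis i 1) * v (j+n) i (q + t *\<^sub>R axis i 1)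
            - u (j+n) (q + t *\<^sub>R axis i 1) * v j i (q + t *\<^sub>R axis i 1)))"

text \<open>For each \<open>t\<close> there is a null set of bad \<open>x\<close>; Fubini in
  \<open>(t, x)\<close> makes one null set of \<open>x\<close> serve almost every
  \<open>t\<close>.\<close>

lemma weak_on_AE_line:
  fixes u v :: "real^'m \<Rightarrow> real"
  assumes w: "weak_on a b i u v"
    and sub: "cbox c (d + r *\<^sub>R axis i 1) \<subseteq> box a b"
  shows "AE x in lborel. x \<in> box c d \<longrightarrow> (AE t in lborel. t \<in> {0..r} \<longrightarrow>
     u (x + t *\<^sub>R axis i 1) - u x = (\<integral>s. indicator {0..t} s * v (x + s *\<^sub>R axis i 1) \<partial>lborel))"
proof -
  let ?e = "axis i 1 :: real^'m"
  have u: "integrable lborel u" and v: "integrable lborel v" using w by (auto simp: weak_on_def)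
  have [measurable]: "u \<in> borel_measurable borel" "v \<in> borel_measurable borel" using u v by auto
  let ?P = "\<lambda>t x. t \<in> {0..r} \<longrightarrow> x \<in> box c d \<longrightarrow>
     u (x + t *\<^sub>R ?e) - u x = (\<integral>s. (if 0 \<le> s \<and> s \<le> t then v (x + s *\<^sub>R ?e) else 0) \<partial>lborel)"
  \<comment> \<open>With \<open>t\<close> varying, the conditional form lets joint measurability in
    \<open>t\<close>, \<open>s\<close> and \<open>x\<close> be established, as the exchange of
    quantifiers requires.\<close>
  have ind: "(\<lambda>s. indicator {0..t} s * v (x + s *\<^sub>R ?e)) = (\<lambda>s. if 0 \<le> s \<and> s \<le> t then v (x + s *\<^sub>R ?e) else 0)" for t x
    by (auto split: split_indicator)
  have "AE x in lborel. ?P t x" for t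
  proof (cases "t \<in> {0..r}")
    case True
    have "cbox c (d + t *\<^sub>R ?e) \<subseteq> cbox c (d + r *\<^sub>R ?e)"
    proof -
      have "t * ?e $ l \<le> r * ?e $ l" for l using True by (auto simp: axis_def)
      then show ?thesis unfolding subset_iff mem_box_cart
        by (smt (verit) vector_add_component vector_scaleR_component real_scaleR_def)
    qed
    with sub have "cbox c (d + t *\<^sub>R ?e) \<subseteq> box a b" by blast
    from weak_on_line[OF w _ this] True show ?thesis by (simp add: ind)
  next
    case False
    then show ?thesis by (intro AE_I2) blast
  qed
  then have "AE t in lborel. AE x in lborel. ?P t x" by simp
  moreover have "{p \<in> space (lborel \<Otimes>\<^sub>M lborel). ?P (fst p) (snd p)} \<in> sets (lborel \<Otimes>\<^sub>M lborel)"
    by measurable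
  ultimately have "AE x in lborel. AE t in lborel. ?P t x"
    by (simp only: lborel_pair.AE_commute)
  then show ?thesis
  proof eventually_elim
    case (elim x)
    then show ?case unfolding ind by (auto elim: AE_mp)
  qed
qed

lemma AE_good_edge:
  fixes u :: "nat \<Rightarrow> real^'m \<Rightarrow> real"
  assumes w: "\<And>k. k \<in> {1..2*n+1} \<Longrightarrow> weak_on a b i (u k) (v k i)"
    and contact: "AE x in lborel. x \<in> box a b \<longrightarrow>
       v (2*n+1) i x = (\<Sum>j=1..n. u j x * v (j+n) i x - u (j+n) x * v j i x)"
    and r: "0 \<le> r" and sub: "cbox c (d + r *\<^sub>R axis i 1) \<subseteq> box a b"
  shows "AE q in lborel. q \<in> box c d \<longrightarrow> good_edge n u v i r q"
proof -
  let ?e = "axis i 1 :: real^'m"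
  have 1: "AE q in lborel. \<forall>k\<in>{1..2*n+1}. integrable lborel (\<lambda>s. indicator {0..r} s * v k i (q + s *\<^sub>R ?e))"
  proof (intro AE_finite_allI)
    fix k assume "k \<in> {1..2*n+1}"
    then have "integrable lborel (v k i)" using w by (auto simp: weak_on_def)
    from lborel_pair.AE_integrable_snd[OF integrable_line_pair1[OF this]]
    show "AE q in lborel. integrable lborel (\<lambda>s. indicator {0..r} s * v k i (q + s *\<^sub>R ?e))" .
  qed simp
  have 2: "AE q in lborel. \<forall>k\<in>{1..2*n+1}. q \<in> box c d \<longrightarrow>
      u k (q + r *\<^sub>R ?e) - u k q = (\<integral>s. indicator {0..r} s * v k i (q + s *\<^sub>R ?e) \<partial>lborel)"
    by (intro AE_finite_allI weak_on_line[OF w r sub]) auto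
  have 3: "AE q in lborel. \<forall>k\<in>{1..2*n+1}. q \<in> box c d \<longrightarrow> (AE t in lborel. t \<in> {0..r} \<longrightarrow>
      u k (q + t *\<^sub>R ?e) - u k q = (\<integral>s. indicator {0..t} s * v k i (q + s *\<^sub>R ?e) \<partial>lborel))"
    by (intro AE_finite_allI weak_on_AE_line[OF w sub]) auto
  show ?thesis
    using 1 2 3 AE_lborel_line[OF contact, of ?e]
  proof eventually_elim
    case (elim q)
    show ?case
    proof
      assume q: "q \<in> box c d"
      have inbox: "q + t *\<^sub>R ?e \<in> box a b" if "t \<in> {0..r}" for t
      proof -
        have "0 \<le> t * ?e $ l" "t * ?e $ l \<le> r * ?e $ l" for l
          using that by (auto simp: axis_def)
        moreover have "c $ l < q $ l \<and> q $ l < d $ l" for l using q by (simp add: mem_box_cart)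
        ultimately have "c $ l \<le> q $ l + t * ?e $ l \<and> q $ l + t * ?e $ l \<le> d $ l + r * ?e $ l" for l
          by (smt (verit))
        then have "q + t *\<^sub>R ?e \<in> cbox c (d + r *\<^sub>R ?e)" by (simp add: mem_box_cart)
        then show ?thesis using sub by blast
      qed
      have "AE t in lborel. t \<in> {0..r} \<longrightarrow> v (2*n+1) i (q + t *\<^sub>R ?e) =
        (\<Sum>j=1..n. u j (q + t *\<^sub>R ?e) * v (j+n) i (q + t *\<^sub>R ?e) - u (j+n) (q + t *\<^sub>R ?e) * v j i (q + t *\<^sub>R ?e))"
        using elim(4) by eventually_elim (use inbox in auto)
      with elim(1-3) q show "good_edge n u v i r q"
        unfolding good_edge_def by blast
    qed
  qed
qed

text \<open>The product is expanded around the models \<open>x + \<beta> + t c1\<close> for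
  \<open>X\<close> and \<open>c2\<close> for \<open>V\<close>. The part with \<open>x\<close> is
  kept exactly, since \<open>x\<close> has no bound; the product of the remaining models is
  integrated explicitly; the error of \<open>V\<close> meets a factor at most \<open>2 r C\<close>,
  and the error of \<open>X\<close> meets the integral of \<open>|V|\<close>.\<close>

lemma edge_product_estimate:
  fixes X V :: "real \<Rightarrow> real"
  assumes V: "integrable lborel (\<lambda>t. indicator {0..r} t * V t)"
    and [measurable]: "X \<in> borel_measurable borel" "V \<in> borel_measurable borel"
    and r: "0 \<le> r" and E: "0 \<le> E"
    and X: "AE t in lborel. t \<in> {0..r} \<longrightarrow> \<bar>X t - (x + \<beta> + t * c1)\<bar> \<le> E"
    and \<beta>: "\<bar>\<beta>\<bar> \<le> r * C" and c1: "\<bar>c1\<bar> \<le> C" and c2: "\<bar>c2\<bar> \<le> C"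
    and D: "(\<integral>t. indicator {0..r} t * \<bar>V t - c2\<bar> \<partial>lborel) \<le> D"
  shows "integrable lborel (\<lambda>t. indicator {0..r} t * (X t * V t))" (is ?int)
    and "\<bar>(\<integral>t. indicator {0..r} t * (X t * V t) \<partial>lborel) - x * (\<integral>t. indicator {0..r} t * V t \<partial>lborel)
        - (r * \<beta> * c2 + c1 * c2 * (r^2 / 2))\<bar> \<le> 2 * r * C * D + E * (r * C + D)" (is ?est)
proof -
  let ?I = "\<lambda>t. indicator {0..r} t :: real"
  have C: "0 \<le> C" using c1 by linarith
  have I: "integrable lborel ?I" using r by simp
  have lin: "integrable lborel (\<lambda>t. ?I t * ((\<beta> + t * c1) * c2))"
    and lin_eq: "(\<integral>t. ?I t * ((\<beta> + t * c1) * c2) \<partial>lborel) = r * \<beta> * c2 + c1 * c2 * (r^2 / 2)"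
  proof -
    have "has_bochner_integral lborel (\<lambda>t. (\<beta> + t * c1) * c2 * ?I t)
       ((\<beta> * r + c1 * (r^2 / 2)) * c2 - (\<beta> * 0 + c1 * (0^2 / 2)) * c2)"
      by (rule has_bochner_integral_FTC_Icc_real[OF r])
         (auto intro!: derivative_eq_intros continuous_intros)
    then show "integrable lborel (\<lambda>t. ?I t * ((\<beta> + t * c1) * c2))"
      "(\<integral>t. ?I t * ((\<beta> + t * c1) * c2) \<partial>lborel) = r * \<beta> * c2 + c1 * c2 * (r^2 / 2)"
      by (auto simp: has_bochner_integral_iff mult.commute algebra_simps)
  qed
  have Vc: "integrable lborel (\<lambda>t. ?I t * (V t - c2))"
    using V I by (simp add: right_diff_distrib)
  have Vc_abs: "integrable lborel (\<lambda>t. ?I t * \<bar>V t - c2\<bar>)"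
    using integrable_abs[OF Vc] by (simp add: abs_mult)
  have V_abs: "integrable lborel (\<lambda>t. ?I t * \<bar>V t\<bar>)"
    using integrable_abs[OF V] by (simp add: abs_mult)
  have third_bd: "\<bar>?I t * ((\<beta> + t * c1) * (V t - c2))\<bar> \<le> 2 * r * C * (?I t * \<bar>V t - c2\<bar>)" for t
  proof (cases "t \<in> {0..r}")
    case True
    have "\<bar>\<beta> + t * c1\<bar> \<le> r * C + r * C"
      using True \<beta> c1 C by (intro order_trans[OF abs_triangle_ineq] add_mono) (auto simp: abs_mult intro!: mult_mono)
    then have "\<bar>\<beta> + t * c1\<bar> \<le> 2 * r * C" by (simp add: mult.commute)
    then show ?thesis using True by (auto simp: abs_mult intro!: mult_right_mono)
  qed simp
  have third: "integrable lborel (\<lambda>t. ?I t * ((\<beta> + t * c1) * (V t - c2)))"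
    by (rule Bochner_Integration.integrable_bound[OF integrable_mult_right[OF Vc_abs, of "2 * r * C"]])
       (use third_bd r C in \<open>auto intro!: AE_I2 simp: abs_mult\<close>)
  have third_le: "\<bar>\<integral>t. ?I t * ((\<beta> + t * c1) * (V t - c2)) \<partial>lborel\<bar> \<le> 2 * r * C * D"
  proof -
    have "\<bar>\<integral>t. ?I t * ((\<beta> + t * c1) * (V t - c2)) \<partial>lborel\<bar> \<le> (\<integral>t. \<bar>?I t * ((\<beta> + t * c1) * (V t - c2))\<bar> \<partial>lborel)"
      by (rule integral_abs_bound)
    also have "\<dots> \<le> (\<integral>t. 2 * r * C * (?I t * \<bar>V t - c2\<bar>) \<partial>lborel)"
      by (rule integral_mono[OF integrable_abs[OF third] integrable_mult_right[OF Vc_abs] third_bd])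
    also have "\<dots> = 2 * r * C * (\<integral>t. ?I t * \<bar>V t - c2\<bar> \<partial>lborel)" by simp
    also have "\<dots> \<le> 2 * r * C * D" using D r C by (intro mult_left_mono) auto
    finally show ?thesis .
  qed
  have fourth_bd: "AE t in lborel. \<bar>?I t * ((X t - (x + \<beta> + t * c1)) * V t)\<bar> \<le> E * (?I t * \<bar>V t\<bar>)"
    using X by eventually_elim (auto simp: abs_mult intro!: mult_right_mono split: split_indicator)
  have fourth: "integrable lborel (\<lambda>t. ?I t * ((X t - (x + \<beta> + t * c1)) * V t))"
    by (rule Bochner_Integration.integrable_bound[OF integrable_mult_right[OF V_abs, of E]])
       (use fourth_bd E in \<open>auto simp: abs_mult\<close>)
  have fourth_le: "\<bar>\<integral>t. ?I t * ((X t - (x + \<beta> + t * c1)) * V t) \<partial>lborel\<bar> \<le> E * (r * C + D)"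
  proof -
    have "\<bar>\<integral>t. ?I t * ((X t - (x + \<beta> + t * c1)) * V t) \<partial>lborel\<bar>
        \<le> (\<integral>t. \<bar>?I t * ((X t - (x + \<beta> + t * c1)) * V t)\<bar> \<partial>lborel)"
      by (rule integral_abs_bound)
    also have "\<dots> \<le> (\<integral>t. E * (?I t * \<bar>V t\<bar>) \<partial>lborel)"
      by (rule integral_mono_AE[OF integrable_abs[OF fourth] integrable_mult_right[OF V_abs] fourth_bd])
    also have "\<dots> = E * (\<integral>t. ?I t * \<bar>V t\<bar> \<partial>lborel)" by simp
    \<comment> \<open>Pointwise \<open>|V| \<le> C + |V - c2|\<close>.\<close>
    also have "(\<integral>t. ?I t * \<bar>V t\<bar> \<partial>lborel) \<le> (\<integral>t. C * ?I t + ?I t * \<bar>V t - c2\<bar> \<partial>lborel)"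
      using c2 by (intro integral_mono V_abs Bochner_Integration.integrable_add integrable_mult_right I Vc_abs)
         (auto split: split_indicator)
    also have "\<dots> = C * r + (\<integral>t. ?I t * \<bar>V t - c2\<bar> \<partial>lborel)"
      using I Vc_abs r by simp
    also have "\<dots> \<le> r * C + D" using D by (simp add: mult.commute)
    finally show ?thesis using E by (simp add: mult_left_mono)
  qed
  have split: "?I t * (X t * V t) = ?I t * V t * x + ?I t * ((\<beta> + t * c1) * c2)
     + ?I t * ((\<beta> + t * c1) * (V t - c2)) + ?I t * ((X t - (x + \<beta> + t * c1)) * V t)" for t
    by (simp add: algebra_simps)
  have x: "integrable lborel (\<lambda>t. ?I t * V t * x)" using V by simp
  show ?int unfolding split
    by (intro Bochner_Integration.integrable_add x lin third fourth)
  have "(\<integral>t. ?I t * (X t * V t) \<partial>lborel) = (\<integral>t. ?I t * V t * x \<partial>lborel) + (\<integral>t. ?I t * ((\<beta> + t * c1) * c2) \<partial>lborel)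
     + (\<integral>t. ?I t * ((\<beta> + t * c1) * (V t - c2)) \<partial>lborel) + (\<integral>t. ?I t * ((X t - (x + \<beta> + t * c1)) * V t) \<partial>lborel)"
    unfolding split
    by (simp only: Bochner_Integration.integral_add Bochner_Integration.integrable_add x lin third fourth)
  moreover have "(\<integral>t. ?I t * V t * x \<partial>lborel) = x * (\<integral>t. ?I t * V t \<partial>lborel)" by simp
  ultimately show ?est
    using third_le fourth_le lin_eq by linarith
qed

text \<open>The linear parts \<open>t c\<^sub>k\<close> of the \<open>u\<^sub>k\<close> do not contribute, because the contact form is
  antisymmetric.\<close>
lemma edge_estimate:
  fixes u :: "nat \<Rightarrow> real^'m \<Rightarrow> real"
  assumes edge: "good_edge n u v i r q"
    and meas: "\<And>k. k \<in> {1..2*n+1} \<Longrightarrow> u k \<in> borel_measurable borel"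
       "\<And>k. k \<in> {1..2*n+1} \<Longrightarrow> v k i \<in> borel_measurable borel"
    and r: "0 \<le> r"
    and \<beta>: "\<And>k. k \<in> {1..2*n} \<Longrightarrow> \<bar>\<beta> k\<bar> \<le> r * C"
    and c: "\<And>k. k \<in> {1..2*n} \<Longrightarrow> \<bar>c k\<bar> \<le> C"
    and D: "\<And>k. k \<in> {1..2*n} \<Longrightarrow> (\<integral>s. indicator {0..r} s * \<bar>v k i (q + s *\<^sub>R axis i 1) - c k\<bar> \<partial>lborel) \<le> D"
    and start: "\<And>k. k \<in> {1..2*n} \<Longrightarrow> \<bar>u k q - (x k + \<beta> k)\<bar> \<le> D"
  shows "\<bar>(u (2*n+1) (q + r *\<^sub>R axis i 1) - u (2*n+1) q)
      - (\<Sum>j=1..n. x j * (u (j+n) (q + r *\<^sub>R axis i 1) - u (j+n) q) - x (j+n) * (u j (q + r *\<^sub>R axis i 1) - u j q))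
      - r * (\<Sum>j=1..n. \<beta> j * c (j+n) - \<beta> (j+n) * c j)\<bar> \<le> n * (8 * r * C * D + 4 * D^2)"
proof -
  let ?I = "\<lambda>t. indicator {0..r} t :: real"
  define X where "X k t = u k (q + t *\<^sub>R axis i 1)" for k t
  define V where "V k t = v k i (q + t *\<^sub>R axis i 1)" for k t
  have Xm: "X k \<in> borel_measurable borel" if "k \<in> {1..2*n+1}" for k
    using meas(1)[OF that] unfolding X_def by measurable
  have Vm: "V k \<in> borel_measurable borel" if "k \<in> {1..2*n+1}" for k
    using meas(2)[OF that] unfolding V_def by measurable
  have V: "integrable lborel (\<lambda>t. ?I t * V k t)" if "k \<in> {1..2*n+1}" for k
    using edge that unfolding good_edge_def V_def by blast
  have \<Delta>: "u k (q + r *\<^sub>R axis i 1) - u k q = (\<integral>t. ?I t * V k t \<partial>lborel)" if "k \<in> {1..2*n+1}" for k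
    using edge that unfolding good_edge_def V_def by blast
  have Xline: "AE t in lborel. t \<in> {0..r} \<longrightarrow> X k t - u k q = (\<integral>s. indicator {0..t} s * V k s \<partial>lborel)"
    if "k \<in> {1..2*n+1}" for k
    using edge that unfolding good_edge_def V_def X_def by blast
  have ct: "AE t in lborel. t \<in> {0..r} \<longrightarrow> V (2*n+1) t = (\<Sum>j=1..n. X j t * V (j+n) t - X (j+n) t * V j t)"
    using edge unfolding good_edge_def V_def X_def by blast
  \<comment> \<open>One \<open>D\<close> comes from the starting value and one from integrating the
    deviation of the derivative from \<open>c k\<close>.\<close>
  have Xest: "AE t in lborel. t \<in> {0..r} \<longrightarrow> \<bar>X k t - (x k + \<beta> k + t * c k)\<bar> \<le> 2 * D"
    if k: "k \<in> {1..2*n}" for k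
  proof -
    have k': "k \<in> {1..2*n+1}" using k by auto
    from Xline[OF k'] show ?thesis
    proof eventually_elim
      case (elim t)
      show ?case
      proof
        assume t: "t \<in> {0..r}"
        have intr: "integrable lborel (\<lambda>s. ?I s * \<bar>V k s - c k\<bar>)"
        proof -
          have "integrable lborel (\<lambda>s. ?I s * V k s - ?I s * c k)" using V[OF k'] r by simp
          from integrable_abs[OF this] show ?thesis
            by (simp add: right_diff_distrib[symmetric] abs_mult)
        qed
        have [measurable]: "V k \<in> borel_measurable borel" by (rule Vm[OF k'])
        have intt: "integrable lborel (\<lambda>s. indicator {0..t} s * V k s)"
          by (rule Bochner_Integration.integrable_bound[OF V[OF k']]) (use t in \<open>auto split: split_indicator\<close>)
        have "(\<integral>s. indicator {0..t} s * V k s \<partial>lborel) - t * c k =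
            (\<integral>s. indicator {0..t} s * V k s - indicator {0..t} s * c k \<partial>lborel)"
          using intt t by simp
        also have "\<bar>\<dots>\<bar> \<le> (\<integral>s. \<bar>indicator {0..t} s * V k s - indicator {0..t} s * c k\<bar> \<partial>lborel)"
          by (rule integral_abs_bound)
        also have "\<dots> \<le> (\<integral>s. ?I s * \<bar>V k s - c k\<bar> \<partial>lborel)"
          by (rule integral_mono'[OF intr]) (use t in \<open>auto split: split_indicator\<close>)
        also have "\<dots> \<le> D" using D[OF k] by (simp add: V_def)
        finally have "\<bar>(\<integral>s. indicator {0..t} s * V k s \<partial>lborel) - t * c k\<bar> \<le> D" .
        then show "\<bar>X k t - (x k + \<beta> k + t * c k)\<bar> \<le> 2 * D"
          using mp[OF elim t] start[OF k] by linarith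
      qed
    qed
  qed
  have D0: "0 \<le> D" if "k \<in> {1..2*n}" for k using start[OF that] by linarith
  \<comment> \<open>This is the bound of \<open>edge_product_estimate\<close> for
    \<open>E = 2 * D\<close>; each \<open>j\<close> uses it twice, which gives the constants 8 and 4
    of the conclusion.\<close>
  let ?K = "4 * r * C * D + 2 * D^2"
  have prod_int: "integrable lborel (\<lambda>t. ?I t * (X k t * V l t))"
    and prod_est: "\<bar>(\<integral>t. ?I t * (X k t * V l t) \<partial>lborel) - x k * (\<integral>t. ?I t * V l t \<partial>lborel)
        - (r * \<beta> k * c l + c k * c l * (r^2 / 2))\<bar> \<le> ?K"
    if k: "k \<in> {1..2*n}" and l: "l \<in> {1..2*n}" for k l
  proof -
    have k': "k \<in> {1..2*n+1}" "l \<in> {1..2*n+1}" using k l by auto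
    have E: "0 \<le> 2 * D" using D0[OF k] by simp
    note * = edge_product_estimate[OF V[OF k'(2)] Xm[OF k'(1)] Vm[OF k'(2)] r E Xest[OF k] \<beta>[OF k] c[OF k] c[OF l] D[OF l, folded V_def]]
    show "integrable lborel (\<lambda>t. ?I t * (X k t * V l t))" by (rule *(1))
    have "2 * r * C * D + 2 * D * (r * C + D) = ?K" by (simp add: algebra_simps power2_eq_square)
    with *(2) show "\<bar>(\<integral>t. ?I t * (X k t * V l t) \<partial>lborel) - x k * (\<integral>t. ?I t * V l t \<partial>lborel)
        - (r * \<beta> k * c l + c k * c l * (r^2 / 2))\<bar> \<le> ?K" by simp
  qed
  have idx: "j \<in> {1..2*n}" "j + n \<in> {1..2*n}" if "j \<in> {1..n}" for j using that by auto
  have "(\<integral>t. ?I t * V (2*n+1) t \<partial>lborel) =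
     (\<integral>t. (\<Sum>j=1..n. ?I t * (X j t * V (j+n) t) - ?I t * (X (j+n) t * V j t)) \<partial>lborel)"
  proof (rule integral_cong_AE)
    have [measurable]: "V (2*n+1) \<in> borel_measurable borel" by (rule Vm) simp
    show "(\<lambda>t. ?I t * V (2*n+1) t) \<in> borel_measurable lborel" by measurable
    show "(\<lambda>t. (\<Sum>j=1..n. ?I t * (X j t * V (j+n) t) - ?I t * (X (j+n) t * V j t))) \<in> borel_measurable lborel"
      by (intro borel_measurable_sum borel_measurable_diff borel_measurable_integrable prod_int idx)
    show "AE t in lborel. ?I t * V (2*n+1) t = (\<Sum>j=1..n. ?I t * (X j t * V (j+n) t) - ?I t * (X (j+n) t * V j t))"
      using ct
    proof eventually_elim
      case (elim t)
      then show ?case by (cases "t \<in> {0..r}") auto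
    qed
  qed
  also have "\<dots> = (\<Sum>j=1..n. (\<integral>t. ?I t * (X j t * V (j+n) t) \<partial>lborel) - (\<integral>t. ?I t * (X (j+n) t * V j t) \<partial>lborel))"
    by (subst Bochner_Integration.integral_sum)
       (auto intro!: sum.cong Bochner_Integration.integral_diff Bochner_Integration.integrable_diff prod_int idx)
  finally have W: "u (2*n+1) (q + r *\<^sub>R axis i 1) - u (2*n+1) q =
     (\<Sum>j=1..n. (\<integral>t. ?I t * (X j t * V (j+n) t) \<partial>lborel) - (\<integral>t. ?I t * (X (j+n) t * V j t) \<partial>lborel))"
    using \<Delta>[of "2*n+1"] by simp
  let ?T = "\<lambda>k l. (\<integral>t. ?I t * (X k t * V l t) \<partial>lborel) - x k * (\<integral>t. ?I t * V l t \<partial>lborel)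
        - (r * \<beta> k * c l + c k * c l * (r^2 / 2))"
  have eq: "(u (2*n+1) (q + r *\<^sub>R axis i 1) - u (2*n+1) q)
      - (\<Sum>j=1..n. x j * (u (j+n) (q + r *\<^sub>R axis i 1) - u (j+n) q) - x (j+n) * (u j (q + r *\<^sub>R axis i 1) - u j q))
      - r * (\<Sum>j=1..n. \<beta> j * c (j+n) - \<beta> (j+n) * c j) = (\<Sum>j=1..n. ?T j (j+n) - ?T (j+n) j)"
    unfolding W sum_distrib_left sum_subtractf[symmetric]
    by (intro sum.cong refl) (simp add: \<Delta> algebra_simps)
  have le: "\<bar>\<Sum>j=1..n. ?T j (j+n) - ?T (j+n) j\<bar> \<le> (\<Sum>j=1..n. 2 * ?K)"
  proof (rule order_trans[OF sum_abs sum_mono])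
    fix j assume "j \<in> {1..n}"
    have "\<bar>a - b\<bar> \<le> 2 * K" if "\<bar>a\<bar> \<le> K" "\<bar>b\<bar> \<le> K" for a b K :: real
      using that by linarith
    from this[OF prod_est[OF idx(1)[OF \<open>j \<in> _\<close>] idx(2)[OF \<open>j \<in> _\<close>]] prod_est[OF idx(2)[OF \<open>j \<in> _\<close>] idx(1)[OF \<open>j \<in> _\<close>]]]
    show "\<bar>?T j (j+n) - ?T (j+n) j\<bar> \<le> 2 * ?K" .
  qed
  have "(\<Sum>j=1..n. 2 * ?K) = n * (8 * r * C * D + 4 * D^2)" by (simp add: algebra_simps)
  with le show ?thesis unfolding eq by metis
qed

text \<open>On the edges leaving \<open>p\<close> the model value starts at \<open>u k p\<close>, so
  their area terms vanish. The two opposite edges start at corners displaced by \<open>r\<close>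
  times the derivative at \<open>p\<close> and contribute the area terms with opposite signs.
  Traversing the contour subtracts one from the other, leaving twice \<open>r^2\<close> times the
  2-form at \<open>p\<close>.\<close>

lemma square_estimate:
  fixes u :: "nat \<Rightarrow> real^'m \<Rightarrow> real"
  assumes edges: "good_edge n u v i r p" "good_edge n u v i' r (p + r *\<^sub>R axis i 1)"
      "good_edge n u v i r (p + r *\<^sub>R axis i' 1)" "good_edge n u v i' r p"
    and meas: "\<And>k. k \<in> {1..2*n+1} \<Longrightarrow> u k \<in> borel_measurable borel"
       "\<And>k l. k \<in> {1..2*n+1} \<Longrightarrow> v k l \<in> borel_measurable borel"
    and r: "0 < r"
    and C: "\<And>k. k \<in> {1..2*n} \<Longrightarrow> \<bar>v k i p\<bar> \<le> C \<and> \<bar>v k i' p\<bar> \<le> C"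
    and D: "\<And>k. k \<in> {1..2*n} \<Longrightarrow> osc (v k i) 0 (axis i 1) r p \<le> D \<and> osc (v k i') (axis i 1) (axis i' 1) r p \<le> D
       \<and> osc (v k i) (axis i' 1) (axis i 1) r p \<le> D \<and> osc (v k i') 0 (axis i' 1) r p \<le> D"
  shows "\<bar>\<Sum>j=1..n. v j i p * v (j+n) i' p - v (j+n) i p * v j i' p\<bar> \<le> 2 * n * (8 * C * (D / r) + 4 * (D / r)^2)"
proof -
  let ?e = "axis i 1 :: real^'m" and ?e' = "axis i' 1 :: real^'m"
  define S where "S = (\<Sum>j=1..n. v j i p * v (j+n) i' p - v (j+n) i p * v j i' p)"
  define B where "B = n * (8 * r * C * D + 4 * D^2)"
  have r0: "0 \<le> r" using r by simp
  \<comment> \<open>The edges leaving \<open>p\<close> locate the values at the starting corners of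
    the opposite edges, up to \<open>D\<close>.\<close>
  have near: "\<bar>u k (p + r *\<^sub>R axis l 1) - (u k p + r * v k l p)\<bar> \<le> D"
    if edge: "good_edge n u v l r p" and k: "k \<in> {1..2*n}" and osc: "osc (v k l) 0 (axis l 1) r p \<le> D" for k l
  proof -
    let ?g = "\<lambda>s. indicator {0..r} s * v k l (p + s *\<^sub>R axis l 1) - indicator {0..r} s * v k l p"
    have k': "k \<in> {1..2*n+1}" using k by auto
    have int: "integrable lborel (\<lambda>s. indicator {0..r} s * v k l (p + s *\<^sub>R axis l 1))"
      and eq: "u k (p + r *\<^sub>R axis l 1) - u k p = (\<integral>s. indicator {0..r} s * v k l (p + s *\<^sub>R axis l 1) \<partial>lborel)"
      using edge k' unfolding good_edge_def by blast+
    have "u k (p + r *\<^sub>R axis l 1) - (u k p + r * v k l p) =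
      (\<integral>s. indicator {0..r} s * v k l (p + s *\<^sub>R axis l 1) \<partial>lborel) - (\<integral>s. indicator {0..r} s * v k l p \<partial>lborel)"
      using eq r by simp
    also have "\<dots> = (\<integral>s. ?g s \<partial>lborel)"
      by (rule Bochner_Integration.integral_diff[symmetric, OF int]) (use r in simp)
    finally have eq': "u k (p + r *\<^sub>R axis l 1) - (u k p + r * v k l p) = (\<integral>s. ?g s \<partial>lborel)" .
    have "\<bar>\<integral>s. ?g s \<partial>lborel\<bar> \<le> (\<integral>s. \<bar>?g s\<bar> \<partial>lborel)"
      by (rule integral_abs_bound)
    also have "\<dots> = osc (v k l) 0 (axis l 1) r p"
      unfolding osc_def by (simp add: right_diff_distrib[symmetric] abs_mult)
    finally show ?thesis unfolding eq' using osc by simp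
  qed
  have D0: "0 \<le> D" if "k \<in> {1..2*n}" for k
    using D[OF that] osc_nonneg[of "v k i" 0 ?e r p] by linarith
  have C0: "0 \<le> C" if "k \<in> {1..2*n}" for k using C[OF that] by linarith
  have bound: "\<bar>r * v k l p\<bar> \<le> r * C" if "k \<in> {1..2*n}" "l = i \<or> l = i'" for k l
    using C[OF that(1)] that(2) r by (auto simp: abs_mult)
  \<comment> \<open>The increment of the last component minus that of the contact form with
    coefficients frozen at \<open>p\<close>; both are increments of functions, so they cancel around
    the square.\<close>
  define F where "F l q = (u (2*n+1) (q + r *\<^sub>R axis l 1) - u (2*n+1) q)
      - (\<Sum>j=1..n. u j p * (u (j+n) (q + r *\<^sub>R axis l 1) - u (j+n) q) - u (j+n) p * (u j (q + r *\<^sub>R axis l 1) - u j q))"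
    for l and q :: "real^'m"
  have 1: "\<bar>F i p - r * (\<Sum>j=1..n. 0 * v (j+n) i p - 0 * v j i p)\<bar> \<le> B"
    unfolding F_def B_def
  proof (rule edge_estimate[OF edges(1) meas r0, where \<beta>="\<lambda>_. 0" and c="\<lambda>k. v k i p" and x="\<lambda>k. u k p"])
    fix k assume k: "k \<in> {1..2*n}"
    show "\<bar>0\<bar> \<le> r * C" using C0[OF k] r by simp
    show "\<bar>v k i p\<bar> \<le> C" using C[OF k] by simp
    show "(\<integral>s. indicator {0..r} s * \<bar>v k i (p + s *\<^sub>R ?e) - v k i p\<bar> \<partial>lborel) \<le> D"
      using D[OF k] by (simp add: osc_def)
    show "\<bar>u k p - (u k p + 0)\<bar> \<le> D" using D0[OF k] by simp
  qed
  have 2: "\<bar>F i' (p + r *\<^sub>R ?e) - r * (\<Sum>j=1..n. r * v j i p * v (j+n) i' p - r * v (j+n) i p * v j i' p)\<bar> \<le> B"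
    unfolding F_def B_def
  proof (rule edge_estimate[OF edges(2) meas r0, where \<beta>="\<lambda>k. r * v k i p" and c="\<lambda>k. v k i' p" and x="\<lambda>k. u k p"])
    fix k assume k: "k \<in> {1..2*n}"
    show "\<bar>r * v k i p\<bar> \<le> r * C" using bound[OF k] by simp
    show "\<bar>v k i' p\<bar> \<le> C" using C[OF k] by simp
    show "(\<integral>s. indicator {0..r} s * \<bar>v k i' (p + r *\<^sub>R ?e + s *\<^sub>R ?e') - v k i' p\<bar> \<partial>lborel) \<le> D"
      using D[OF k] by (simp add: osc_def)
    show "\<bar>u k (p + r *\<^sub>R ?e) - (u k p + r * v k i p)\<bar> \<le> D" using near[OF edges(1) k] D[OF k] by simp
  qed
  have 3: "\<bar>F i (p + r *\<^sub>R ?e') - r * (\<Sum>j=1..n. r * v j i' p * v (j+n) i p - r * v (j+n) i' p * v j i p)\<bar> \<le> B"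
    unfolding F_def B_def
  proof (rule edge_estimate[OF edges(3) meas r0, where \<beta>="\<lambda>k. r * v k i' p" and c="\<lambda>k. v k i p" and x="\<lambda>k. u k p"])
    fix k assume k: "k \<in> {1..2*n}"
    show "\<bar>r * v k i' p\<bar> \<le> r * C" using bound[OF k] by simp
    show "\<bar>v k i p\<bar> \<le> C" using C[OF k] by simp
    show "(\<integral>s. indicator {0..r} s * \<bar>v k i (p + r *\<^sub>R ?e' + s *\<^sub>R ?e) - v k i p\<bar> \<partial>lborel) \<le> D"
      using D[OF k] by (simp add: osc_def)
    show "\<bar>u k (p + r *\<^sub>R ?e') - (u k p + r * v k i' p)\<bar> \<le> D" using near[OF edges(4) k] D[OF k] by simp
  qed
  have 4: "\<bar>F i' p - r * (\<Sum>j=1..n. 0 * v (j+n) i' p - 0 * v j i' p)\<bar> \<le> B"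
    unfolding F_def B_def
  proof (rule edge_estimate[OF edges(4) meas r0, where \<beta>="\<lambda>_. 0" and c="\<lambda>k. v k i' p" and x="\<lambda>k. u k p"])
    fix k assume k: "k \<in> {1..2*n}"
    show "\<bar>0\<bar> \<le> r * C" using C0[OF k] r by simp
    show "\<bar>v k i' p\<bar> \<le> C" using C[OF k] by simp
    show "(\<integral>s. indicator {0..r} s * \<bar>v k i' (p + s *\<^sub>R ?e') - v k i' p\<bar> \<partial>lborel) \<le> D"
      using D[OF k] by (simp add: osc_def)
    show "\<bar>u k p - (u k p + 0)\<bar> \<le> D" using D0[OF k] by simp
  qed
  \<comment> \<open>Both paths from \<open>p\<close> lead to the same opposite corner;
    \<open>sw\<close> identifies its two expressions.\<close>
  have closed: "F i p + F i' (p + r *\<^sub>R ?e) - F i (p + r *\<^sub>R ?e') - F i' p = 0"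
  proof -
    have sw: "p + r *\<^sub>R ?e' + r *\<^sub>R ?e = p + r *\<^sub>R ?e + r *\<^sub>R ?e'" by (simp add: add_ac)
    have "(\<Sum>j=1..n. u j p * (u (j+n) (p + r *\<^sub>R ?e) - u (j+n) p) - u (j+n) p * (u j (p + r *\<^sub>R ?e) - u j p))
      + (\<Sum>j=1..n. u j p * (u (j+n) (p + r *\<^sub>R ?e + r *\<^sub>R ?e') - u (j+n) (p + r *\<^sub>R ?e)) - u (j+n) p * (u j (p + r *\<^sub>R ?e + r *\<^sub>R ?e') - u j (p + r *\<^sub>R ?e)))
      = (\<Sum>j=1..n. u j p * (u (j+n) (p + r *\<^sub>R ?e + r *\<^sub>R ?e') - u (j+n) (p + r *\<^sub>R ?e')) - u (j+n) p * (u j (p + r *\<^sub>R ?e + r *\<^sub>R ?e') - u j (p + r *\<^sub>R ?e')))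
      + (\<Sum>j=1..n. u j p * (u (j+n) (p + r *\<^sub>R ?e') - u (j+n) p) - u (j+n) p * (u j (p + r *\<^sub>R ?e') - u j p))"
      unfolding sum.distrib[symmetric] by (intro sum.cong refl) (simp add: algebra_simps)
    then show ?thesis unfolding F_def sw by linarith
  qed
  have m2: "r * (\<Sum>j=1..n. r * v j i p * v (j+n) i' p - r * v (j+n) i p * v j i' p) = r^2 * S"
    unfolding S_def sum_distrib_left by (intro sum.cong) (auto simp: power2_eq_square algebra_simps)
  have m3: "r * (\<Sum>j=1..n. r * v j i' p * v (j+n) i p - r * v (j+n) i' p * v j i p) = - (r^2 * S)"
    unfolding S_def sum_distrib_left sum_negf[symmetric]
    by (intro sum.cong) (auto simp: power2_eq_square algebra_simps)
  have "\<bar>F i p\<bar> \<le> B" "\<bar>F i' (p + r *\<^sub>R ?e) - r^2 * S\<bar> \<le> B" "\<bar>F i (p + r *\<^sub>R ?e') + r^2 * S\<bar> \<le> B" "\<bar>F i' p\<bar> \<le> B"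
    using 1 2 3 4 unfolding m2 m3 by simp_all
  \<comment> \<open>Four edges, each with error at most \<open>B\<close>, against an area term
    counted twice.\<close>
  with closed have "2 * \<bar>r^2 * S\<bar> \<le> 4 * B" by linarith
  moreover have "\<bar>r^2 * S\<bar> = \<bar>S\<bar> * r^2" by (simp add: abs_mult)
  ultimately have "\<bar>S\<bar> * r^2 \<le> 2 * B" by linarith
  then have "\<bar>S\<bar> \<le> 2 * B / r^2" using r by (simp add: pos_le_divide_eq)
  also have "\<dots> = 2 * n * (8 * C * (D / r) + 4 * (D / r)^2)"
    using r by (simp add: B_def field_simps power2_eq_square)
  finally show ?thesis by (simp add: S_def)
qed

text \<open>The isotropy sum does not depend on the side of the square, so a sequence of sides
  tending to 0 is enough. The margin \<open>R\<close> in both directions keeps every square with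
  corner in \<open>box c d\<close> inside \<open>box a b\<close>.\<close>

lemma AE_isotropic_box:
  fixes u :: "nat \<Rightarrow> real^'m \<Rightarrow> real"
  assumes w: "\<And>k l. k \<in> {1..2*n+1} \<Longrightarrow> weak_on a b l (u k) (v k l)"
    and contact: "\<And>l. AE x in lborel. x \<in> box a b \<longrightarrow>
       v (2*n+1) l x = (\<Sum>j=1..n. u j x * v (j+n) l x - u (j+n) x * v j l x)"
    and R: "0 < R" and sub: "cbox c (d + R *\<^sub>R axis i 1 + R *\<^sub>R axis i' 1) \<subseteq> box a b"
  shows "AE x in lborel. x \<in> box c d \<longrightarrow> (\<Sum>j=1..n. v j i x * v (j+n) i' x - v (j+n) i x * v j i' x) = 0"
proof -
  let ?e = "axis i 1 :: real^'m" and ?e' = "axis i' 1 :: real^'m"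
  define r where "r m = R * inverse (real (Suc m))" for m
  have r: "0 < r m" "0 \<le> r m" "r m \<le> R" for m
    using R by (auto simp: r_def field_simps)
  have r0: "r \<longlonglongrightarrow> 0"
    using tendsto_mult_left[OF LIMSEQ_inverse_real_of_nat, of R] by (simp add: r_def[abs_def])
  have v: "integrable lborel (v k l)" if "k \<in> {1..2*n+1}" for k l
    using w[OF that] by (simp add: weak_on_def)
  have meas: "u k \<in> borel_measurable borel" "v k l \<in> borel_measurable borel" if "k \<in> {1..2*n+1}" for k l
    using w[OF that, of l] by (auto simp: weak_on_def)
  have incl: "cbox (c + y) (d + y') \<subseteq> box a b"
    if "\<And>l. 0 \<le> y $ l" "\<And>l. y' $ l \<le> R * ?e $ l + R * ?e' $ l" for y y'
  proof -
    have "cbox (c + y) (d + y') \<subseteq> cbox c (d + R *\<^sub>R ?e + R *\<^sub>R ?e')"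
      using that unfolding subset_iff mem_box_cart vector_add_component vector_scaleR_component real_scaleR_def
      by (smt (verit))
    then show ?thesis using sub by blast
  qed
  have ax: "0 \<le> r m * axis l 1 $ l'" "r m * axis l 1 $ l' \<le> R * axis l 1 $ l'" for m and l l' :: 'm
    using r[of m] by (auto simp: axis_def)
  have RR: "0 \<le> R * axis l 1 $ l'" for l l' :: 'm using R by (auto simp: axis_def)
  have edge0: "AE p in lborel. p \<in> box c d \<longrightarrow> good_edge n u v l (r m) (p + y)"
    if "\<And>l'. 0 \<le> y $ l'" "\<And>l'. (y + r m *\<^sub>R axis l 1) $ l' \<le> R * ?e $ l' + R * ?e' $ l'" for l m y
  proof -
    have "cbox (c + y) ((d + y) + r m *\<^sub>R axis l 1) \<subseteq> box a b"
      using incl[OF that] by (simp add: add.assoc)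
    then have "AE q in lborel. q \<in> box (c + y) (d + y) \<longrightarrow> good_edge n u v l (r m) q"
      using AE_good_edge[where u=u and v=v and i=l and n=n and a=a and b=b, OF w contact r(2)] by blast
    from AE_lborel_shift[OF this, of y] show ?thesis
      by (simp add: mem_box_cart)
  qed
  \<comment> \<open>Countably many sides, each with its own null set of corners, still give a common
    null set.\<close>
  have edges: "AE p in lborel. \<forall>m. p \<in> box c d \<longrightarrow> good_edge n u v i (r m) p \<and> good_edge n u v i' (r m) (p + r m *\<^sub>R ?e)
     \<and> good_edge n u v i (r m) (p + r m *\<^sub>R ?e') \<and> good_edge n u v i' (r m) p"
  proof (subst AE_all_countable, rule allI)
    fix m
    have b: "r m * ?e $ l \<le> R * ?e $ l + R * ?e' $ l" "r m * ?e' $ l \<le> R * ?e $ l + R * ?e' $ l"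
      "r m * ?e $ l + r m * ?e' $ l \<le> R * ?e $ l + R * ?e' $ l"
      "r m * ?e' $ l + r m * ?e $ l \<le> R * ?e $ l + R * ?e' $ l" for l
      using ax[of m i l] ax[of m i' l] RR[of i l] RR[of i' l] by linarith+
    have 1: "AE p in lborel. p \<in> box c d \<longrightarrow> good_edge n u v i (r m) (p + 0)"
      by (rule edge0) (use b in auto)
    have 2: "AE p in lborel. p \<in> box c d \<longrightarrow> good_edge n u v i' (r m) (p + r m *\<^sub>R ?e)"
      by (rule edge0) (use b ax in auto)
    have 3: "AE p in lborel. p \<in> box c d \<longrightarrow> good_edge n u v i (r m) (p + r m *\<^sub>R ?e')"
      by (rule edge0) (use b ax in auto)
    have 4: "AE p in lborel. p \<in> box c d \<longrightarrow> good_edge n u v i' (r m) (p + 0)"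
      by (rule edge0) (use b in auto)
    show "AE p in lborel. p \<in> box c d \<longrightarrow> good_edge n u v i (r m) p \<and> good_edge n u v i' (r m) (p + r m *\<^sub>R ?e)
       \<and> good_edge n u v i (r m) (p + r m *\<^sub>R ?e') \<and> good_edge n u v i' (r m) p"
      using 1 2 3 4 by eventually_elim simp
  qed
  define \<Delta> where "\<Delta> m k x = osc (v k i) 0 ?e (r m) x + osc (v k i') ?e ?e' (r m) x
     + osc (v k i) ?e' ?e (r m) x + osc (v k i') 0 ?e' (r m) x" for m k x
  \<comment> \<open>A single function bounding \<open>D / r\<close> for all components and all four
    edges, so that one subsequence serves them together.\<close>
  define \<delta> where "\<delta> m x = (\<Sum>k=1..2*n. \<Delta> m k x) / r m" for m x
  have \<Delta>0: "0 \<le> \<Delta> m k x" for m k x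
    unfolding \<Delta>_def by (intro add_nonneg_nonneg osc_nonneg)
  have \<delta>0: "0 \<le> \<delta> m x" for m x
    unfolding \<delta>_def by (intro divide_nonneg_pos sum_nonneg \<Delta>0 r)
  have \<Delta>_int: "integrable lborel (\<Delta> m k)" if "k \<in> {1..2*n}" for m k
    unfolding \<Delta>_def using that by (intro Bochner_Integration.integrable_add osc_L1(1) v r) auto
  have \<delta>_int: "integrable lborel (\<delta> m)" for m
    unfolding \<delta>_def by (intro integrable_divide_zero Bochner_Integration.integrable_sum \<Delta>_int)
  have \<Delta>_lim: "(\<lambda>m. (\<integral>x. \<Delta> m k x \<partial>lborel) / r m) \<longlonglongrightarrow> 0" if "k \<in> {1..2*n}" for k
  proof -
    have k: "k \<in> {1..2*n+1}" using that by auto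
    note o = osc_L1(1)[OF v[OF k] r(2)]
    have "(\<lambda>m. (\<integral>x. osc (v k i) 0 ?e (r m) x \<partial>lborel) / r m + (\<integral>x. osc (v k i') ?e ?e' (r m) x \<partial>lborel) / r m
      + (\<integral>x. osc (v k i) ?e' ?e (r m) x \<partial>lborel) / r m + (\<integral>x. osc (v k i') 0 ?e' (r m) x \<partial>lborel) / r m)
      \<longlonglongrightarrow> 0 + 0 + 0 + 0"
      by (intro tendsto_add osc_average_tendsto_0 v k r0 r)
    moreover have "(\<integral>x. \<Delta> m k x \<partial>lborel) / r m =
        (\<integral>x. osc (v k i) 0 ?e (r m) x \<partial>lborel) / r m + (\<integral>x. osc (v k i') ?e ?e' (r m) x \<partial>lborel) / r m
      + (\<integral>x. osc (v k i) ?e' ?e (r m) x \<partial>lborel) / r m + (\<integral>x. osc (v k i') 0 ?e' (r m) x \<partial>lborel) / r m" for m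
      unfolding \<Delta>_def
      by (simp only: Bochner_Integration.integral_add Bochner_Integration.integrable_add o add_divide_distrib)
    ultimately show ?thesis by simp
  qed
  have "(\<lambda>m. \<integral>x. norm (\<delta> m x) \<partial>lborel) \<longlonglongrightarrow> 0"
  proof -
    have "(\<integral>x. norm (\<delta> m x) \<partial>lborel) = (\<Sum>k=1..2*n. (\<integral>x. \<Delta> m k x \<partial>lborel) / r m)" for m
    proof -
      have "(\<integral>x. norm (\<delta> m x) \<partial>lborel) = (\<integral>x. (\<Sum>k=1..2*n. \<Delta> m k x) / r m \<partial>lborel)"
      proof -
        have "norm (\<delta> m x) = \<delta> m x" for x by (simp add: \<delta>0)
        then show ?thesis by (simp only: \<delta>_def)
      qed
      also have "\<dots> = (\<Sum>k=1..2*n. (\<integral>x. \<Delta> m k x \<partial>lborel)) / r m"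
        by (simp only: integral_divide_zero Bochner_Integration.integral_sum \<Delta>_int)
      finally show ?thesis by (simp only: sum_divide_distrib)
    qed
    moreover have "(\<lambda>m. \<Sum>k=1..2*n. (\<integral>x. \<Delta> m k x \<partial>lborel) / r m) \<longlonglongrightarrow> (\<Sum>k=1..2*n. 0)"
      by (intro tendsto_sum \<Delta>_lim)
    ultimately show ?thesis by simp
  qed
  \<comment> \<open>Convergence in \<open>L^1\<close> gives pointwise convergence almost everywhere
    along a subsequence.\<close>
  from tendsto_L1_AE_subseq[OF \<delta>_int this]
  obtain \<rho> where "AE x in lborel. (\<lambda>m. \<delta> (\<rho> m) x) \<longlonglongrightarrow> 0" by blast
  with edges show ?thesis
  proof eventually_elim
    case (elim p)
    show ?case
    proof
      assume p: "p \<in> box c d"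
      let ?S = "\<Sum>j=1..n. v j i p * v (j+n) i' p - v (j+n) i p * v j i' p"
      \<comment> \<open>The bound may depend on \<open>p\<close>, because the point is fixed while
        the side shrinks.\<close>
      define C where "C = (\<Sum>k=1..2*n. \<bar>v k i p\<bar> + \<bar>v k i' p\<bar>)"
      have C: "\<bar>v k i p\<bar> \<le> C \<and> \<bar>v k i' p\<bar> \<le> C" if "k \<in> {1..2*n}" for k
      proof -
        have "\<bar>v k i p\<bar> + \<bar>v k i' p\<bar> \<le> C"
          unfolding C_def by (rule member_le_sum[OF that]) auto
        then show ?thesis by linarith
      qed
      have est: "\<bar>?S\<bar> \<le> 2 * n * (8 * C * \<delta> m p + 4 * (\<delta> m p)^2)" for m
        unfolding \<delta>_def
      proof (rule square_estimate[where u=u])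
        fix k assume k: "k \<in> {1..2*n}"
        have "\<Delta> m k p \<le> (\<Sum>k=1..2*n. \<Delta> m k p)"
          by (rule member_le_sum[OF k]) (auto simp: \<Delta>0)
        then show "osc (v k i) 0 ?e (r m) p \<le> (\<Sum>k=1..2*n. \<Delta> m k p) \<and>
            osc (v k i') ?e ?e' (r m) p \<le> (\<Sum>k=1..2*n. \<Delta> m k p) \<and>
            osc (v k i) ?e' ?e (r m) p \<le> (\<Sum>k=1..2*n. \<Delta> m k p) \<and>
            osc (v k i') 0 ?e' (r m) p \<le> (\<Sum>k=1..2*n. \<Delta> m k p)"
          using osc_nonneg[of "v k i" 0 ?e "r m" p] osc_nonneg[of "v k i'" ?e ?e' "r m" p]
            osc_nonneg[of "v k i" ?e' ?e "r m" p] osc_nonneg[of "v k i'" 0 ?e' "r m" p]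
          unfolding \<Delta>_def[of m k p] by linarith
        show "\<bar>v k i p\<bar> \<le> C \<and> \<bar>v k i' p\<bar> \<le> C" by (rule C[OF k])
      qed (use elim(1) p r meas in auto)
      have "(\<lambda>m. 2 * n * (8 * C * \<delta> (\<rho> m) p + 4 * (\<delta> (\<rho> m) p)^2)) \<longlonglongrightarrow> 2 * n * (8 * C * 0 + 4 * 0^2)"
        by (intro tendsto_intros elim(2))
      from LIMSEQ_le_const[OF this] est have "\<bar>?S\<bar> \<le> 2 * n * (8 * C * 0 + 4 * 0^2)" by blast
      then show "?S = 0" by simp
    qed
  qed
qed

section \<open>Localization\<close>

text \<open>The data are Lebesgue measurable and only locally integrable. Cutting off to a compact
  box and choosing a Borel representative makes measurability on product spaces and global
  integrability available.\<close>

lemma loc_integrable_borel_version: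
  fixes f :: "real^'m \<Rightarrow> real"
  assumes "loc_integrable \<Omega> f" "cbox a b \<subseteq> \<Omega>"
  shows "\<exists>u. integrable lborel u \<and> (AE x in lborel. x \<in> cbox a b \<longrightarrow> u x = f x)"
proof -
  have "f absolutely_integrable_on cbox a b"
    using assms compact_cbox unfolding loc_integrable_def by blast
  then have int: "integrable lebesgue (\<lambda>x. indicator (cbox a b) x *\<^sub>R f x)"
    by (simp add: set_integrable_def)
  then obtain u where u: "u \<in> borel_measurable lborel" "AE x in lborel. indicator (cbox a b) x *\<^sub>R f x = u x"
    using completion_ex_borel_measurable_real by blast
  have "integrable lebesgue u"
    by (rule integrable_cong_AE_imp[OF int])
       (use u in \<open>auto intro: measurable_completion AE_completion elim!: AE_mp\<close>)
  then have "integrable lborel u" using u(1) by (simp add: integrable_completion)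
  moreover have "AE x in lborel. x \<in> cbox a b \<longrightarrow> u x = f x"
    using u(2) by eventually_elim auto
  ultimately show ?thesis by blast
qed

text \<open>Bridges the gauge integral over \<Omega> in the definition of weak derivatives and the
  Lebesgue integral of the representative: off the box both integrands vanish, and inside they
  differ on a null set only.\<close>

lemma integral_localized:
  fixes f u h :: "real^'m \<Rightarrow> real"
  assumes u: "integrable lborel u" and ae: "AE x in lborel. x \<in> cbox a b \<longrightarrow> u x = f x"
    and sub: "cbox a b \<subseteq> \<Omega>" and h: "continuous_on UNIV h" "\<And>x. x \<notin> cbox a b \<Longrightarrow> h x = 0"
  shows "integral \<Omega> (\<lambda>x. f x * h x) = (\<integral>x. u x * h x \<partial>lborel)"
proof -
  have [measurable]: "u \<in> borel_measurable borel" "h \<in> borel_measurable borel"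
    using u borel_measurable_continuous_onI[OF h(1)] by auto
  have "bounded (h ` cbox a b)"
    by (intro compact_imp_bounded compact_continuous_image continuous_on_subset[OF h(1)]) auto
  then obtain B where B: "\<And>x. x \<in> cbox a b \<Longrightarrow> \<bar>h x\<bar> \<le> B" by (auto simp: bounded_iff)
  have int: "integrable lborel (\<lambda>x. u x * h x)"
  proof (rule Bochner_Integration.integrable_bound[OF integrable_mult_left[OF u, of "\<bar>B\<bar>"]])
    show "AE x in lborel. norm (u x * h x) \<le> norm (u x * \<bar>B\<bar>)"
    proof (rule AE_I2)
      fix x
      have "\<bar>h x\<bar> \<le> \<bar>B\<bar>" using B[of x] h(2)[of x] by (cases "x \<in> cbox a b") auto
      then show "norm (u x * h x) \<le> norm (u x * \<bar>B\<bar>)" by (simp add: abs_mult mult_left_mono)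
    qed
  qed measurable
  obtain N where N: "N \<in> null_sets lborel" "{x \<in> space lborel. \<not> (x \<in> cbox a b \<longrightarrow> u x = f x)} \<subseteq> N"
    using ae by (auto simp: eventually_ae_filter)
  have neg: "negligible N" using N(1) by (simp add: negligible_iff_null_sets null_sets_completionI)
  have "((\<lambda>x. u x * h x) has_integral (\<integral>x. u x * h x \<partial>lborel)) UNIV"
    by (rule has_integral_integral_lborel[OF int])
  then have "((\<lambda>x. if x \<in> \<Omega> then f x * h x else 0) has_integral (\<integral>x. u x * h x \<partial>lborel)) UNIV"
    by (rule has_integral_spike[OF neg, rotated]) (use N(2) h(2) sub in force)
  then have "((\<lambda>x. f x * h x) has_integral (\<integral>x. u x * h x \<partial>lborel)) \<Omega>"
    by (simp add: has_integral_restrict_UNIV)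
  then show ?thesis by (rule integral_unique)
qed

lemma smooth_fun_partial:
  fixes \<phi> :: "real^'m \<Rightarrow> real"
  assumes "smooth_fun \<phi>"
  shows "continuous_on UNIV \<phi>" "continuous_on UNIV (partial i \<phi>)"
proof -
  obtain D :: "'m list \<Rightarrow> real^'m \<Rightarrow> real" where D: "D [] = \<phi>"
    "\<And>ks x. (D ks has_derivative (\<lambda>h. \<Sum>i\<in>UNIV. h $ i * D (i # ks) x)) (at x)"
    using assms unfolding smooth_fun_def by blast
  have cont: "continuous_on UNIV (D ks)" for ks
    using has_derivative_continuous[OF D(2)] by (intro continuous_at_imp_continuous_on) auto
  then show "continuous_on UNIV \<phi>" using D(1) by metis
  have "partial i \<phi> x = D [i] x" for x
  proof -
    have "frechet_derivative \<phi> (at x) = (\<lambda>h. \<Sum>i\<in>UNIV. h $ i * D [i] x)"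
      using frechet_derivative_at[OF D(2)[of "[]" x]] by (simp add: D(1))
    then have "partial i \<phi> x = (\<Sum>j\<in>UNIV. axis i 1 $ j * D [j] x)" by (simp add: partial_def)
    also have "\<dots> = (\<Sum>j\<in>UNIV. if j = i then D [j] x else 0)"
      by (intro sum.cong) (auto simp: axis_def)
    finally show ?thesis by simp
  qed
  then have "partial i \<phi> = D [i]" by blast
  then show "continuous_on UNIV (partial i \<phi>)" using cont by simp
qed

lemma partial_zero_outside_support:
  assumes "x \<notin> closure {x. \<phi> x \<noteq> 0}"
  shows "partial i \<phi> x = 0"
proof -
  have "((\<lambda>_. 0) has_derivative (\<lambda>_. 0)) (at x)" by simp
  then have "(\<phi> has_derivative (\<lambda>_. 0)) (at x)"
  proof (rule has_derivative_transform_within_open)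
    show "open (- closure {x. \<phi> x \<noteq> 0})" by auto
    show "0 = \<phi> y" if "y \<in> - closure {x. \<phi> x \<noteq> 0}" for y
      using that closure_subset by force
  qed (use assms in auto)
  from frechet_derivative_at[OF this, symmetric] show ?thesis by (simp add: partial_def)
qed

lemma weak_partial_imp_weak_on:
  fixes f :: "real^'m \<Rightarrow> real"
  assumes w: "weak_partial \<Omega> f i g" and sub: "cbox a b \<subseteq> \<Omega>"
    and u: "integrable lborel u" "AE x in lborel. x \<in> cbox a b \<longrightarrow> u x = f x"
    and v: "integrable lborel v" "AE x in lborel. x \<in> cbox a b \<longrightarrow> v x = g x"
  shows "weak_on a b i u v"
  unfolding weak_on_def
proof (intro conjI allI impI u v)
  fix \<phi> assume t: "test_fun (box a b) \<phi>"
  then have sm: "smooth_fun \<phi>" and supp: "closure {x. \<phi> x \<noteq> 0} \<subseteq> box a b"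
    by (auto simp: test_fun_def)
  have "test_fun \<Omega> \<phi>" using t sub box_subset_cbox unfolding test_fun_def by blast
  then have W: "integral \<Omega> (\<lambda>x. f x * partial i \<phi> x) = - integral \<Omega> (\<lambda>x. g x * \<phi> x)"
    using w by (auto simp: weak_partial_def)
  have out: "x \<notin> closure {x. \<phi> x \<noteq> 0}" if "x \<notin> cbox a b" for x
    using that supp box_subset_cbox by blast
  have z: "\<phi> x = 0" if "x \<notin> cbox a b" for x
    using out[OF that] closure_subset[of "{x. \<phi> x \<noteq> 0}"] by auto
  have "integral \<Omega> (\<lambda>x. f x * partial i \<phi> x) = (\<integral>x. u x * partial i \<phi> x \<partial>lborel)"
    by (rule integral_localized[OF u sub smooth_fun_partial(2)[OF sm] partial_zero_outside_support[OF out]])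
  moreover have "integral \<Omega> (\<lambda>x. g x * \<phi> x) = (\<integral>x. v x * \<phi> x \<partial>lborel)"
    by (rule integral_localized[OF v sub smooth_fun_partial(1)[OF sm] z])
  ultimately show "(\<integral>x. u x * partial i \<phi> x \<partial>lborel) = - (\<integral>x. v x * \<phi> x \<partial>lborel)"
    using W by simp
qed

lemma nested_boxes:
  fixes x :: "real^'m"
  assumes "open \<Omega>" "x \<in> \<Omega>"
  obtains a b c d R where "cbox a b \<subseteq> \<Omega>" "x \<in> box c d" "0 < R"
    "\<And>i i'. cbox c (d + R *\<^sub>R axis i 1 + R *\<^sub>R axis i' 1) \<subseteq> box a b"
proof -
  obtain \<epsilon> where \<epsilon>: "\<epsilon> > 0" "ball x \<epsilon> \<subseteq> \<Omega>" using assms openE by blast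
  \<comment> \<open>A point of the cube of half-side \<open>4 * R\<close> has \<open>l^1\<close>
    distance at most \<open>4 * R * CARD('m)\<close>, that is \<epsilon>/2, from the centre.\<close>
  define R where "R = \<epsilon> / (8 * CARD('m))"
  have R: "R > 0" using \<epsilon> by (simp add: R_def)
  let ?v = "\<lambda>t::real. (\<chi> l. t) :: real^'m"
  show ?thesis
  \<comment> \<open>For \<open>i = i'\<close> the inner cube of half-side \<open>R\<close> is
    extended by \<open>2 * R\<close>, reaching \<open>3 * R\<close>; half-side \<open>4 * R\<close>
    makes the inclusion into the open box strict.\<close>
  proof (rule that[of "x - ?v (4 * R)" "x + ?v (4 * R)" "x - ?v R" "x + ?v R" R])
    show "cbox (x - ?v (4 * R)) (x + ?v (4 * R)) \<subseteq> \<Omega>"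
    proof
      fix y assume y: "y \<in> cbox (x - ?v (4 * R)) (x + ?v (4 * R))"
      then have "x $ l - 4 * R \<le> y $ l \<and> y $ l \<le> x $ l + 4 * R" for l
        by (simp add: mem_box_cart)
      then have "\<bar>(x - y) $ l\<bar> \<le> 4 * R" for l by (smt (verit) vector_minus_component)
      then have "(\<Sum>l\<in>UNIV. \<bar>(x - y) $ l\<bar>) \<le> (\<Sum>l\<in>(UNIV::'m set). 4 * R)"
        by (intro sum_mono)
      also have "\<dots> = \<epsilon> / 2" by (simp add: R_def)
      finally have "norm (x - y) \<le> \<epsilon> / 2" using norm_le_l1_cart[of "x - y"] by linarith
      then show "y \<in> \<Omega>" using \<epsilon> by (auto simp: subset_iff dist_norm)
    qed
    show "x \<in> box (x - ?v R) (x + ?v R)" using R by (simp add: mem_box_cart)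
    show "0 < R" by (rule R)
    fix i i' :: 'm
    show "cbox (x - ?v R) (x + ?v R + R *\<^sub>R axis i 1 + R *\<^sub>R axis i' 1) \<subseteq> box (x - ?v (4 * R)) (x + ?v (4 * R))"
    proof
      fix y assume y: "y \<in> cbox (x - ?v R) (x + ?v R + R *\<^sub>R axis i 1 + R *\<^sub>R axis i' 1)"
      have "x $ l - R \<le> y $ l \<and> y $ l \<le> x $ l + R + R * axis i 1 $ l + R * axis i' 1 $ l" for l
        using y by (simp add: mem_box_cart)
      moreover have "R * axis i 1 $ l \<le> R" for i l :: 'm using R by (simp add: axis_def)
      ultimately have "x $ l - 4 * R < y $ l \<and> y $ l < x $ l + 4 * R" for l
        using R by (smt (verit))
      then show "y \<in> box (x - ?v (4 * R)) (x + ?v (4 * R))" by (simp add: mem_box_cart)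
    qed
  qed
qed

section \<open>From local isotropy to the rank bound\<close>

text \<open>Row rank is the convenient form of the rank: the rows are the differentials, and both
  the isotropy relation and the contact equation are linear-algebraic statements about them at a
  point.\<close>

theorem theorem6p2:
  fixes n :: nat
    and \<Omega> :: "(real^'m) set"
    and f :: "nat \<Rightarrow> real^'m \<Rightarrow> real"
    and Df :: "nat \<Rightarrow> 'm \<Rightarrow> real^'m \<Rightarrow> real"
  assumes "0 < n"
    and "n + 1 \<le> CARD('m)" and "CARD('m) \<le> 2 * n"
    and "open \<Omega>"
    and "\<And>k i. k \<in> {1..2*n+1} \<Longrightarrow> weak_partial \<Omega> (f k) i (Df k i)"
    and "AE x in lebesgue. x \<in> \<Omega> \<longrightarrow>
           (\<forall>i. Df (2*n+1) i x =
                 (\<Sum>j=1..n. f j x * Df (j+n) i x - f (j+n) x * Df j i x))"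
  shows "AE x in lebesgue. x \<in> \<Omega> \<longrightarrow>
           dim ((\<lambda>k. (\<chi> i. Df k i x) :: real^'m) ` {1..2*n+1}) \<le> n"
proof -
  have contact: "AE x in lborel. x \<in> \<Omega> \<longrightarrow>
      (\<forall>i. Df (2*n+1) i x = (\<Sum>j=1..n. f j x * Df (j+n) i x - f (j+n) x * Df j i x))"
    using assms(6) by (simp add: AE_completion_iff)
  \<comment> \<open>These are the coefficients of the 2-form that is the sum of df^j \<and>
    df^{j+n}.\<close>
  define P where "P x \<longleftrightarrow> (\<forall>i i'. (\<Sum>j=1..n. Df j i x * Df (j+n) i' x - Df (j+n) i x * Df j i' x) = 0)" for x
  have local: "\<exists>S. open S \<and> x \<in> S \<and> (AE y in lborel. y \<in> S \<longrightarrow> P y)" if x: "x \<in> \<Omega>" for x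
  proof -
    obtain a b c d R where box: "cbox a b \<subseteq> \<Omega>" "x \<in> box c d" "0 < R"
      "\<And>i i'. cbox c (d + R *\<^sub>R axis i 1 + R *\<^sub>R axis i' 1) \<subseteq> box a b"
      using nested_boxes[OF assms(4) x] by metis
    have "\<exists>u. integrable lborel u \<and> (AE x in lborel. x \<in> cbox a b \<longrightarrow> u x = f k x)" if "k \<in> {1..2*n+1}" for k
      using assms(5)[OF that] box(1) by (intro loc_integrable_borel_version) (auto simp: weak_partial_def)
    then obtain u where u: "\<And>k. k \<in> {1..2*n+1} \<Longrightarrow> integrable lborel (u k)"
      "\<And>k. k \<in> {1..2*n+1} \<Longrightarrow> AE x in lborel. x \<in> cbox a b \<longrightarrow> u k x = f k x" by metis
    have "\<exists>v. integrable lborel v \<and> (AE x in lborel. x \<in> cbox a b \<longrightarrow> v x = Df k i x)" if "k \<in> {1..2*n+1}" for k i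
      using assms(5)[OF that] box(1) by (intro loc_integrable_borel_version) (auto simp: weak_partial_def)
    then obtain v where v: "\<And>k i. k \<in> {1..2*n+1} \<Longrightarrow> integrable lborel (v k i)"
      "\<And>k i. k \<in> {1..2*n+1} \<Longrightarrow> AE x in lborel. x \<in> cbox a b \<longrightarrow> v k i x = Df k i x" by metis
    \<comment> \<open>Finitely many components and directions, so all representatives agree with the
      data outside one null set.\<close>
    have eq: "AE x in lborel. x \<in> cbox a b \<longrightarrow> (\<forall>k\<in>{1..2*n+1}. u k x = f k x \<and> (\<forall>i. v k i x = Df k i x))"
    proof -
      have "AE x in lborel. \<forall>k\<in>{1..2*n+1}. x \<in> cbox a b \<longrightarrow> u k x = f k x"
        by (intro AE_finite_allI u) auto
      moreover have "AE x in lborel. \<forall>k\<in>{1..2*n+1}. \<forall>i\<in>UNIV. x \<in> cbox a b \<longrightarrow> v k i x = Df k i x"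
        by (intro AE_finite_allI v) auto
      ultimately show ?thesis by eventually_elim blast
    qed
    have idx: "j \<in> {1..2*n+1}" "j + n \<in> {1..2*n+1}" "2*n+1 \<in> {1..2*n+1}" if "j \<in> {1..n}" for j
      using that by auto
    have "weak_on a b i (u k) (v k i)" if "k \<in> {1..2*n+1}" for k i
      by (rule weak_partial_imp_weak_on[OF assms(5)[OF that] box(1) u(1)[OF that] u(2)[OF that] v(1)[OF that] v(2)[OF that]])
    moreover have "AE x in lborel. x \<in> box a b \<longrightarrow>
       v (2*n+1) i x = (\<Sum>j=1..n. u j x * v (j+n) i x - u (j+n) x * v j i x)" for i
      using contact eq
    proof eventually_elim
      case (elim x)
      show ?case
      proof
        assume "x \<in> box a b"
        then have x: "x \<in> cbox a b" "x \<in> \<Omega>" using box_subset_cbox box(1) by blast+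
        have e: "u k x = f k x" "v k i x = Df k i x" if "k \<in> {1..2*n+1}" for k
          using elim(2) x(1) that by blast+
        have "v (2*n+1) i x = Df (2*n+1) i x" by (rule e) simp
        also have "\<dots> = (\<Sum>j=1..n. f j x * Df (j+n) i x - f (j+n) x * Df j i x)"
          using elim(1) x(2) by blast
        also have "\<dots> = (\<Sum>j=1..n. u j x * v (j+n) i x - u (j+n) x * v j i x)"
          by (rule sum.cong[OF refl]) (simp only: e[OF idx(1)] e[OF idx(2)])
        finally show "v (2*n+1) i x = (\<Sum>j=1..n. u j x * v (j+n) i x - u (j+n) x * v j i x)" .
      qed
    qed
    ultimately have iso: "AE x in lborel. x \<in> box c d \<longrightarrow>
        (\<Sum>j=1..n. v j i x * v (j+n) i' x - v (j+n) i x * v j i' x) = 0" for i i'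
      using AE_isotropic_box[where u=u and v=v and n=n and a=a and b=b, OF _ _ box(3,4)] by blast
    have "AE x in lborel. \<forall>i\<in>UNIV. \<forall>i'\<in>UNIV. x \<in> box c d \<longrightarrow>
        (\<Sum>j=1..n. v j i x * v (j+n) i' x - v (j+n) i x * v j i' x) = 0"
      by (intro AE_finite_allI iso) auto
    with eq have "AE y in lborel. y \<in> box c d \<longrightarrow> P y"
    proof eventually_elim
      case (elim y)
      show ?case
      proof
        assume y: "y \<in> box c d"
        have "box c d \<subseteq> cbox a b"
        proof -
          have "d $ l \<le> (d + R *\<^sub>R axis i 1 + R *\<^sub>R axis i 1) $ l" for i l :: 'm
            using box(3) by (simp add: axis_def)
          then have "box c d \<subseteq> cbox c (d + R *\<^sub>R axis i 1 + R *\<^sub>R axis i 1)" for i :: 'm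
            unfolding subset_iff mem_box_cart by (meson less_imp_le order_trans)
          then show ?thesis using box(4) box_subset_cbox by blast
        qed
        with y have yc: "y \<in> cbox a b" by blast
        have e: "v k i y = Df k i y" if "k \<in> {1..2*n+1}" for k i
          using elim(1) yc that by blast
        show "P y" unfolding P_def
        proof (intro allI)
          fix i i'
          have "(\<Sum>j=1..n. Df j i y * Df (j+n) i' y - Df (j+n) i y * Df j i' y) =
            (\<Sum>j=1..n. v j i y * v (j+n) i' y - v (j+n) i y * v j i' y)"
            by (rule sum.cong[OF refl]) (simp only: e[OF idx(1)] e[OF idx(2)])
          also have "\<dots> = 0" using elim(2) y by blast
          finally show "(\<Sum>j=1..n. Df j i y * Df (j+n) i' y - Df (j+n) i y * Df j i' y) = 0" .
        qed
      qed
    qed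
    then show ?thesis using box(2) open_box by blast
  qed
  \<comment> \<open>By the Lindelof property countably many local neighbourhoods cover \<Omega>, and
    countably many null sets have a null union.\<close>
  define \<F> where "\<F> = {S. open S \<and> (AE y in lborel. y \<in> S \<longrightarrow> P y)}"
  obtain \<F>' where \<F>': "\<F>' \<subseteq> \<F>" "countable \<F>'" "\<Union>\<F>' = \<Union>\<F>"
    using Lindelof[of \<F>] by (auto simp: \<F>_def)
  have cover: "\<Omega> \<subseteq> \<Union>\<F>'"
    unfolding \<F>'(3) using local by (auto simp: \<F>_def)
  have "AE y in lborel. \<forall>S\<in>\<F>'. y \<in> S \<longrightarrow> P y"
    using \<F>'(1,2) by (subst AE_ball_countable) (auto simp: \<F>_def)
  then have iso: "AE y in lborel. y \<in> \<Omega> \<longrightarrow> P y"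
    by eventually_elim (use cover in blast)
  have "AE x in lborel. x \<in> \<Omega> \<longrightarrow> dim ((\<lambda>k. (\<chi> i. Df k i x) :: real^'m) ` {1..2*n+1}) \<le> n"
    using iso contact
  proof eventually_elim
    case (elim x)
    show ?case
    proof
      assume x: "x \<in> \<Omega>"
      define A where "A k = ((\<chi> i. Df k i x) :: real^'m)" for k
      let ?V = "A ` {1..n} \<union> (\<lambda>j. A (j+n)) ` {1..n}"
      have dim: "dim ?V \<le> n"
        using dim_isotropic_le[of "{1..n}" A "\<lambda>j. A (j+n)"] elim(1) x by (simp add: P_def A_def)
      have low: "A k \<in> span ?V" if "k \<in> {1..2*n}" for k
      proof (cases "k \<le> n")
        case True
        then show ?thesis using that by (intro span_base) auto
      next
        case False
        then have "k = (k - n) + n" "k - n \<in> {1..n}" using that by auto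
        then show ?thesis by (intro span_base UnI2) (metis imageI)
      qed
      \<comment> \<open>The contact equation, read row by row, makes the last row a combination of
        the others with coefficients \<open>f j x\<close> and \<open>- f (j+n) x\<close>.\<close>
      have "A (2*n+1) = (\<Sum>j=1..n. f j x *\<^sub>R A (j+n) - f (j+n) x *\<^sub>R A j)"
        using elim(2) x by (simp add: A_def vec_eq_iff)
      moreover have "(\<Sum>j=1..n. f j x *\<^sub>R A (j+n) - f (j+n) x *\<^sub>R A j) \<in> span ?V"
        by (intro span_sum span_diff span_scale low) auto
      ultimately have top: "A (2*n+1) \<in> span ?V" by metis
      have "A ` {1..2*n+1} \<subseteq> span ?V"
      proof (rule image_subsetI)
        fix k assume "k \<in> {1..2*n+1}"
        then show "A k \<in> span ?V" using low[of k] top by (cases "k = 2*n+1") auto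
      qed
      then have "dim (A ` {1..2*n+1}) \<le> dim (span ?V)" by (rule dim_subset)
      with dim show "dim ((\<lambda>k. (\<chi> i. Df k i x) :: real^'m) ` {1..2*n+1}) \<le> n"
        by (simp add: A_def[abs_def])
    qed
  qed
  then show ?thesis by (rule AE_completion)
qed

end
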